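(* Let $\Omega\subsetneq\mathbb{C}$ be a domain, let $K_\Omega(z)$ denote its Bergman kernel on the diagonal and $\delta_\Omega(z)=\operatorname{dist}(z,\partial\Omega)$. All inequalities below are assumed to hold for all $z\in\Omega$ with $\delta_\Omega(z)$ sufficiently small (i.e. as $z\to\partial\Omega$). (1) If $\Omega$ is bounded and there is a constant $c>0$ with $K_\Omega(z)\ge c\,\delta_\Omega(z)^{-2}$ as $z\to\partial\Omega$, then $\partial\Omega$ is uniformly perfect. (2) If there is a constant $M>0$ with $K_\Omega(z)\ge \dfrac{M}{\delta_\Omega(z)^2\log\frac{1}{\delta_\Omega(z)}}$ as $z\to\partial\Omega$, then there exists $\alpha>1$ such that $\partial\Omega$ satisfies condition $(U)_{1,\alpha}$. If moreover $M>\frac{1}{2\pi}$, then $\alpha$ can be chosen in $(1,2)$. (3) If there is a constant $c>0$ with $K_\Omega(z)\ge \dfrac{c}{\delta_\Omega(z)^2\log\log\frac{1}{\delta_\Omega(z)}}$ as $z\to\partial\Omega$, then there exists $\beta>0$ such that $\partial\Omega$ satisfies condition $(U)_{2,\beta}$.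
   Context: The Bergman kernel $K_\Omega(z)=K_\Omega(z,z)$ is the reproducing kernel on the diagonal of the Bergman space $A^2(\Omega)$ of holomorphic functions on $\Omega$ that are square integrable with respect to Lebesgue measure. A closed set $K\subset\mathbb{C}$ is uniformly perfect if there is a constant $C\in(0,1)$ such that $\{z\in\mathbb{C}: Cr\le|z-a|\le r\}\cap K\neq\emptyset$ for every $a\in K$ and every $r\in(0,\operatorname{diam}(K))$. For an increasing function $h$ on $[0,r_0)$ with $h(r)\le r$, a closed set $K\subset\mathbb{C}$ is $h$-uniformly perfect if $\{z\in\mathbb{C}: h(r)\le|z-a|\le r\}\cap K\neq\emptyset$ for every $a\in K$ and every $r\in(0,r_0)$. Let $h_{1,\alpha}(r)=r^\alpha$ ($\alpha>1$) and $h_{2,\beta}(r)=r(-\log r)^{-\beta}$ ($\beta>0$). A closed set satisfies condition $(U)_{1,\alpha}$ (resp. $(U)_{2,\beta}$) if there exist constants $C>0$ and $r_0>0$ such that it is $Ch_{1,\alpha}$-uniformly perfect (resp. $Ch_{2,\beta}$-uniformly perfect) with that $r_0$. *)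

theory Defs
  imports "HOL-Complex_Analysis.Complex_Analysis"
begin

definition bergman_space :: "complex set \<Rightarrow> (complex \<Rightarrow> complex) set" where
  "bergman_space \<Omega> = {f. f holomorphic_on \<Omega> \<and>
      set_integrable lborel \<Omega> (\<lambda>\<zeta>. (cmod (f \<zeta>))\<^sup>2)}"

definition bergman_kernel2 :: "complex set \<Rightarrow> complex \<Rightarrow> complex \<Rightarrow> complex" where
  "bergman_kernel2 \<Omega> \<zeta> w =
     (THE k. k \<in> bergman_space \<Omega> \<and> (\<forall>z. z \<notin> \<Omega> \<longrightarrow> k z = 0) \<and>
        (\<forall>f\<in>bergman_space \<Omega>. f w = (LINT \<xi>:\<Omega>|lborel. f \<xi> * cnj (k \<xi>)))) \<zeta>"

definition bergman_kernel :: "complex set \<Rightarrow> complex \<Rightarrow> real" where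
  "bergman_kernel \<Omega> z = Re (bergman_kernel2 \<Omega> z z)"

definition boundary_dist :: "complex set \<Rightarrow> complex \<Rightarrow> real" where
  "boundary_dist \<Omega> z = infdist z (frontier \<Omega>)"

definition uniformly_perfect :: "complex set \<Rightarrow> bool" where
  "uniformly_perfect K \<longleftrightarrow> closed K \<and>
     (\<exists>C. 0 < C \<and> C < 1 \<and> (\<forall>a\<in>K. \<forall>r. 0 < r \<and> r < diameter K \<longrightarrow>
        (\<exists>z\<in>K. C * r \<le> cmod (z - a) \<and> cmod (z - a) \<le> r)))"

definition h_uniformly_perfect :: "(real \<Rightarrow> real) \<Rightarrow> real \<Rightarrow> complex set \<Rightarrow> bool" where
  "h_uniformly_perfect h r0 K \<longleftrightarrow> closed K \<and> 0 < r0 \<and>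
     mono_on {0..<r0} h \<and> (\<forall>r\<in>{0..<r0}. h r \<le> r) \<and>
     (\<forall>a\<in>K. \<forall>r. 0 < r \<and> r < r0 \<longrightarrow>
        (\<exists>z\<in>K. h r \<le> cmod (z - a) \<and> cmod (z - a) \<le> r))"

definition h1 :: "real \<Rightarrow> real \<Rightarrow> real" where
  "h1 \<alpha> r = r powr \<alpha>"

definition h2 :: "real \<Rightarrow> real \<Rightarrow> real" where
  "h2 \<beta> r = r * (- ln r) powr (- \<beta>)"

definition condU1 :: "real \<Rightarrow> complex set \<Rightarrow> bool" where
  "condU1 \<alpha> K \<longleftrightarrow> (\<exists>C r0. C > 0 \<and> r0 > 0 \<and> h_uniformly_perfect (\<lambda>r. C * h1 \<alpha> r) r0 K)"

definition condU2 :: "real \<Rightarrow> complex set \<Rightarrow> bool" where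
  "condU2 \<beta> K \<longleftrightarrow> (\<exists>C r0. C > 0 \<and> r0 > 0 \<and> h_uniformly_perfect (\<lambda>r. C * h2 \<beta> r) r0 K)"

end

theory Submission
  imports Defs "HOL-Real_Asymp.Real_Asymp"
begin

text \<open>Suppose that \<open>\<partial>\<Omega>\<close> misses the annulus \<open>A = {r e\<^sup>-\<^sup>L \<le> |z - a| \<le> r}\<close> of modulus \<open>L\<close> around some
  \<open>a \<in> \<partial>\<Omega>\<close>. If \<open>r e\<^sup>-\<^sup>L\<close> is small compared with the inradius of \<open>\<Omega>\<close>, connectedness gives \<open>A \<subseteq> \<Omega>\<close>. For \<open>f\<close>
  in the Bergman space the term \<open>c / (z - a)\<close> dominates the Laurent expansion of \<open>f\<close> on \<open>A\<close>: the residue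
  \<open>c\<close> is the mean of \<open>(w - a) f(w)\<close> over every circle in \<open>A\<close>, so integrating the mean square over \<open>A\<close> gives
  \<open>2\<pi>L |c|\<^sup>2 \<le> \<parallel>f\<parallel>\<^sup>2\<close>, while by Cauchy's formula the remaining terms contribute
  \<open>O(1/L + L e\<^sup>-\<^sup>L) \<parallel>f\<parallel>\<close> to \<open>|z - a| |f(z)|\<close> on the circle \<open>|z - a| = \<rho> = r / L\<close>. Hence
  \<open>K(z) \<rho>\<^sup>2 \<le> (1 + o(1)) / (2\<pi>L)\<close> there. As \<open>dist(z, \<partial>\<Omega>) \<le> \<rho>\<close>, a lower bound \<open>K \<ge> c / (\<delta>\<^sup>2 \<phi>(\<delta>))\<close> near \<open>\<partial>\<Omega>\<close> is
  violated as soon as \<open>\<phi>(r / L) \<le> \<kappa> L\<close> with \<open>\<kappa> < 2\<pi>c\<close> and \<open>L\<close> is large. For \<open>\<phi> = 1\<close> a large constant \<open>L\<close>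
  will do, for \<open>\<phi>(t) = log (1/t)\<close> and \<open>\<phi>(t) = log log (1/t)\<close> one takes \<open>L = (\<alpha> - 1) log (1/r)\<close> and
  \<open>L = \<beta> log log (1/r)\<close>, that is \<open>r e\<^sup>-\<^sup>L = r\<^sup>\<alpha>\<close> and \<open>r e\<^sup>-\<^sup>L = r (- log r)\<^sup>-\<^sup>\<beta>\<close>.\<close>

section \<open>Isometries and radial integration\<close>

lemma open_eq_disjoint_balls_ae:
  fixes U :: "'a::euclidean_space set"
  assumes "open U"
  obtains C :: "('a \<times> real) set"
  where "countable C" "C \<subseteq> {p. ball (fst p) (snd p) \<subseteq> U \<and> 0 < snd p}"
    "disjoint_family_on (\<lambda>p. ball (fst p) (snd p)) C"
    "emeasure lborel U = emeasure lborel (\<Union>p\<in>C. ball (fst p) (snd p))"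
proof -
  let ?B = "\<lambda>p. ball (fst p) (snd p) :: 'a set"
  have "\<exists>p. p \<in> {p. ?B p \<subseteq> U \<and> 0 < snd p} \<and> x \<in> ?B p \<and> snd p < d" if "x \<in> U" "0 < d" for x d
  proof -
    obtain e where "0 < e" "ball x e \<subseteq> U"
      using \<open>open U\<close> \<open>x \<in> U\<close> openE by blast
    moreover have "ball x (min e (d / 2)) \<subseteq> ball x e"
      by (rule subset_ball) simp
    ultimately show ?thesis
      using \<open>0 < d\<close> by (intro exI[of _ "(x, min e (d / 2))"]) auto
  qed
  from Vitali_covering_theorem_balls[of U _ fst snd, OF this]
  obtain C :: "('a \<times> real) set" where "countable C" and C: "C \<subseteq> {p. ?B p \<subseteq> U \<and> 0 < snd p}"
    and disj: "pairwise (\<lambda>p q. disjnt (?B p) (?B q)) C" and neg: "negligible (U - \<Union> (?B ` C))"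
    by blast
  have "open (\<Union> (?B ` C))"
    by blast
  then have "U - \<Union> (?B ` C) \<in> null_sets lborel"
    using neg \<open>open U\<close> by (simp add: negligible_iff_null_sets null_sets_completion_iff)
  then have "emeasure lborel (\<Union> (?B ` C) \<union> (U - \<Union> (?B ` C))) = emeasure lborel (\<Union> (?B ` C))"
    using \<open>open (\<Union> (?B ` C))\<close> by (intro emeasure_Un_null_set) auto
  moreover have "\<Union> (?B ` C) \<union> (U - \<Union> (?B ` C)) = U"
    using C by blast
  ultimately have "emeasure lborel U = emeasure lborel (\<Union> (?B ` C))"
    by simp
  moreover have "disjoint_family_on ?B C"
    using disj by (simp add: disjoint_family_on_def pairwise_def disjnt_def)
  ultimately show thesis
    using \<open>countable C\<close> C by (intro that)
qed

lemma emeasure_le_emeasure_isometry_image: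
  fixes f :: "'a::euclidean_space \<Rightarrow> 'a"
  assumes iso: "\<And>x y. dist (f x) (f y) = dist x y" and "surj f"
    and "open U" and fU: "f ` U \<in> sets borel"
  shows "emeasure lborel U \<le> emeasure lborel (f ` U)"
proof -
  let ?B = "\<lambda>p. ball (fst p) (snd p) :: 'a set"
  have f_ball: "f ` ball x r = ball (f x) r" for x r
    using iso \<open>surj f\<close> by (force simp: image_iff surj_def)
  have "inj f"
    using iso by (metis dist_eq_0_iff injI)
  obtain C :: "('a \<times> real) set" where "countable C" and C: "C \<subseteq> {p. ?B p \<subseteq> U \<and> 0 < snd p}"
    and disj: "disjoint_family_on ?B C" and U: "emeasure lborel U = emeasure lborel (\<Union>p\<in>C. ?B p)"
    using open_eq_disjoint_balls_ae[OF \<open>open U\<close>] .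
  have disj_f: "disjoint_family_on (\<lambda>p. f ` ?B p) C"
    unfolding disjoint_family_on_def
    by (simp only: image_Int[OF \<open>inj f\<close>, symmetric])
      (use disj in \<open>simp add: disjoint_family_on_def\<close>)
  note U
  also have "emeasure lborel (\<Union>p\<in>C. ?B p) = (\<integral>\<^sup>+p. emeasure lborel (?B p) \<partial>count_space C)"
    using disj \<open>countable C\<close> by (intro emeasure_UN_countable) auto
  also have "\<dots> = (\<integral>\<^sup>+p. emeasure lborel (f ` ?B p) \<partial>count_space C)"
    using C by (intro nn_integral_cong) (auto simp: f_ball emeasure_ball)
  also have "\<dots> = emeasure lborel (\<Union>p\<in>C. f ` ?B p)"
    using disj_f \<open>countable C\<close>
    by (intro emeasure_UN_countable[symmetric]) (auto simp: f_ball)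
  also have "\<dots> \<le> emeasure lborel (f ` U)"
    using C fU by (intro emeasure_mono) auto
  finally show ?thesis .
qed

lemma distr_lborel_isometry:
  fixes f :: "'a::euclidean_space \<Rightarrow> 'a"
  assumes iso: "\<And>x y. dist (f x) (f y) = dist x y" and "surj f"
  shows "distr lborel borel f = lborel"
proof (rule lborel_eqI[symmetric])
  have "inj f"
    using iso by (metis dist_eq_0_iff injI)
  note bij = bijI[OF \<open>inj f\<close> \<open>surj f\<close>]
  have iso_inv: "dist (inv f x) (inv f y) = dist x y" for x y
    using iso \<open>surj f\<close> by (metis surj_f_inv_f)
  have "continuous_on UNIV f"
    unfolding continuous_on_iff using iso by metis
  then have [measurable]: "f \<in> borel_measurable borel"
    by (rule borel_measurable_continuous_onI)
  fix l u :: 'a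
  assume lu: "\<And>b. b \<in> Basis \<Longrightarrow> l \<bullet> b \<le> u \<bullet> b"
  have "open (f -` box l u)"
    using \<open>continuous_on UNIV f\<close> by (intro open_vimage open_box)
  have image: "f ` (f -` box l u) = box l u"
    using \<open>surj f\<close> by (rule surj_image_vimage_eq)
  have "emeasure lborel (f -` box l u) \<le> emeasure lborel (box l u)"
    using emeasure_le_emeasure_isometry_image[OF iso \<open>surj f\<close> \<open>open (f -` box l u)\<close>]
    unfolding image by simp
  moreover have "emeasure lborel (box l u) \<le> emeasure lborel (f -` box l u)"
    using emeasure_le_emeasure_isometry_image[OF iso_inv bij_is_surj[OF bij_imp_bij_inv[OF bij]] open_box,
        of l u] \<open>open (f -` box l u)\<close>
    by (simp add: bij_vimage_eq_inv_image[OF bij])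
  ultimately show "emeasure (distr lborel borel f) (box l u) = (\<Prod>b\<in>Basis. (u - l) \<bullet> b)"
    using lu by (simp add: emeasure_distr emeasure_lborel_box antisym)
qed simp

lemma distr_lborel_dist:
  fixes a :: "'a::euclidean_space"
  defines "n \<equiv> DIM('a)"
  shows "distr lborel borel (dist a)
    = density lborel (\<lambda>t. ennreal (n * unit_ball_vol n * t ^ (n - 1)) * indicator {0..} t)"
    (is "?M = ?N")
proof (rule measure_eqI_generator_eq)
  show "Int_stable (range atMost :: real set set)"
    by (auto simp: Int_stable_def)
  show "range atMost \<subseteq> Pow (UNIV :: real set)" "range (\<lambda>i. {..real i}) \<subseteq> range atMost"
    by auto
  show "sets ?M = sigma_sets UNIV (range atMost)" "sets ?N = sigma_sets UNIV (range atMost)"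
    by (auto simp: borel_eq_atMost)
  show "(\<Union>i. {..real i}) = UNIV"
    using real_arch_simple by auto
  have emeasure_atMost: "emeasure ?M {..t} = ennreal (unit_ball_vol n * t ^ n) * indicator {0..} t"
    "emeasure ?N {..t} = ennreal (unit_ball_vol n * t ^ n) * indicator {0..} t" for t
  proof -
    have "emeasure ?M {..t} = emeasure lborel (cball a t)"
      by (simp add: emeasure_distr vimage_def cball_def)
    then show "emeasure ?M {..t} = ennreal (unit_ball_vol n * t ^ n) * indicator {0..} t"
      unfolding n_def by (cases "0 \<le> t") (auto simp: emeasure_cball)
    have "emeasure ?N {..t}
        = (\<integral>\<^sup>+x. ennreal (n * unit_ball_vol n * x ^ (n - 1)) * indicator {0..t} x \<partial>lborel)"
      by (subst emeasure_density) (auto intro!: nn_integral_cong simp: indicator_def)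
    also have "\<dots> = ennreal (unit_ball_vol n * t ^ n) * indicator {0..} t"
    proof (cases "0 \<le> t")
      case True
      then have "(\<integral>\<^sup>+x. ennreal (n * unit_ball_vol n * x ^ (n - 1)) * indicator {0..t} x \<partial>lborel)
          = ennreal (unit_ball_vol n * t ^ n - unit_ball_vol n * 0 ^ n)"
        by (intro nn_integral_FTC_Icc) (auto intro!: derivative_eq_intros)
      with True show ?thesis
        by (simp add: n_def)
    qed simp
    finally show "emeasure ?N {..t} = ennreal (unit_ball_vol n * t ^ n) * indicator {0..} t" .
  qed
  show "emeasure ?M X = emeasure ?N X" if "X \<in> range atMost" for X
    using that emeasure_atMost by auto
  show "emeasure ?M {..real i} \<noteq> \<infinity>" for i
    unfolding emeasure_atMost by (auto simp: indicator_def)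
qed

definition closed_annulus :: "'a::metric_space \<Rightarrow> real \<Rightarrow> real \<Rightarrow> 'a set" where
  "closed_annulus a s r = {z. s \<le> dist a z \<and> dist a z \<le> r}"

lemma mem_closed_annulus [simp]: "z \<in> closed_annulus a s r \<longleftrightarrow> s \<le> dist a z \<and> dist a z \<le> r"
  by (simp add: closed_annulus_def)

lemma closed_annulus_borel [measurable]: "closed_annulus a s r \<in> sets borel"
proof -
  have "closed_annulus a s r = cball a r - ball a s"
    by auto
  then show ?thesis
    by simp
qed

lemma nn_integral_inverse_square_annulus:
  fixes a :: complex
  assumes "0 < s" "s \<le> r"
  shows "(\<integral>\<^sup>+z\<in>closed_annulus a s r. ennreal (1 / (dist a z)\<^sup>2) \<partial>lborel) = ennreal (2 * pi * ln (r / s))"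
proof -
  have "(\<integral>\<^sup>+z\<in>closed_annulus a s r. ennreal (1 / (dist a z)\<^sup>2) \<partial>lborel)
      = (\<integral>\<^sup>+t. ennreal (1 / t\<^sup>2) * indicator {s..r} t \<partial>distr lborel borel (dist a))"
    by (subst nn_integral_distr)
       (auto intro!: nn_integral_cong simp: indicator_def)
  also have "\<dots> = (\<integral>\<^sup>+t. ennreal (2 * pi / t) * indicator {s..r} t \<partial>lborel)"
    unfolding distr_lborel_dist using assms
    by (subst nn_integral_density)
       (auto intro!: nn_integral_cong
        simp: indicator_def unit_ball_vol_2 power2_eq_square simp flip: ennreal_mult)
  also have "\<dots> = ennreal (2 * pi * ln r - 2 * pi * ln s)"
    by (rule nn_integral_FTC_Icc) (use assms in \<open>auto intro!: derivative_eq_intros\<close>)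
  also have "\<dots> = ennreal (2 * pi * ln (r / s))"
    using assms by (simp add: ln_div algebra_simps)
  finally show ?thesis .
qed

section \<open>Circle means\<close>

definition circle_through :: "complex \<Rightarrow> complex \<Rightarrow> real \<Rightarrow> complex" where
  "circle_through a z x = a + cis (2 * pi * x) * (z - a)"

definition circle_mean :: "(complex \<Rightarrow> complex) \<Rightarrow> complex \<Rightarrow> complex \<Rightarrow> complex" where
  "circle_mean h a z = integral {0..1} (\<lambda>x. h (circle_through a z x))"

lemma dist_circle_through [simp]: "dist a (circle_through a z x) = dist a z"
  by (simp add: circle_through_def dist_norm norm_mult norm_minus_commute)

lemma continuous_on_circle_through [continuous_intros]: "continuous_on A (circle_through a z)"
  unfolding circle_through_def by (intro continuous_intros)

lemma circle_through_eq_exp: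
  "circle_through a z = (\<lambda>x. a + exp (2 * of_real pi * \<i> * of_real x) * (z - a))"
  by (auto simp: circle_through_def cis_conv_exp mult_ac)

lemma circlepath_eq_circle_through: "circlepath a r = circle_through a (a + of_real r)"
  by (simp add: circlepath circle_through_eq_exp mult_ac)

lemma has_vector_derivative_circle_through:
  "(circle_through a z has_vector_derivative 2 * of_real pi * \<i> * (circle_through a z x - a))
    (at x within A)"
  unfolding circle_through_eq_exp
  by (rule has_vector_derivative_real_field) (auto intro!: derivative_eq_intros)

lemma valid_path_circle_through: "valid_path (circle_through a z)"
proof -
  have "valid_path ((\<lambda>u. a + u * (z - a)) \<circ> circlepath 0 1)"
    by (rule valid_path_compose_holomorphic[where S = UNIV]) (auto intro!: holomorphic_intros)
  moreover have "(\<lambda>u. a + u * (z - a)) \<circ> circlepath 0 1 = circle_through a z"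
    by (auto simp: circlepath_eq_circle_through circle_through_def)
  ultimately show ?thesis
    by simp
qed

lemma continuous_on_compose_circle_through:
  assumes "continuous_on (sphere a (dist a z)) h"
  shows "continuous_on A (\<lambda>x. h (circle_through a z x))"
  by (rule continuous_on_compose2[OF assms]) (auto intro: continuous_intros)

lemma circle_mean_cong:
  assumes "\<And>w. dist a w = dist a z \<Longrightarrow> f w = g w"
  shows "circle_mean f a z = circle_mean g a z"
  unfolding circle_mean_def using assms by (intro integral_cong) simp

lemma circle_mean_add:
  assumes "continuous_on (sphere a (dist a z)) f" "continuous_on (sphere a (dist a z)) g"
  shows "circle_mean (\<lambda>w. f w + g w) a z = circle_mean f a z + circle_mean g a z"
  unfolding circle_mean_def
  by (intro integral_add integrable_continuous_real continuous_on_compose_circle_through assms)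

lemma circle_mean_diff:
  assumes "continuous_on (sphere a (dist a z)) f" "continuous_on (sphere a (dist a z)) g"
  shows "circle_mean (\<lambda>w. f w - g w) a z = circle_mean f a z - circle_mean g a z"
  unfolding circle_mean_def
  by (intro integral_diff integrable_continuous_real continuous_on_compose_circle_through assms)

lemma circle_mean_cmult: "circle_mean (\<lambda>w. c * f w) a z = c * circle_mean f a z"
  by (simp add: circle_mean_def)

lemma norm_circle_mean_le:
  assumes h: "continuous_on (sphere a (dist a z)) h"
    and bound: "\<And>w. dist a w = dist a z \<Longrightarrow> cmod (h w) \<le> B"
  shows "cmod (circle_mean h a z) \<le> B"
proof -
  have "cmod (circle_mean h a z) \<le> B * (1 - 0)"
    unfolding circle_mean_def
    by (rule integral_bound) (use bound continuous_on_compose_circle_through[OF h] in auto)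
  then show ?thesis
    by simp
qed

lemma circle_mean_eq_contour_integral:
  assumes "z \<noteq> a"
  shows "circle_mean h a z
    = contour_integral (circle_through a z) (\<lambda>w. h w / (w - a)) / (2 * of_real pi * \<i>)"
proof -
  have "h (circle_through a z x) / (circle_through a z x - a)
        * (2 * of_real pi * \<i> * (circle_through a z x - a))
      = 2 * of_real pi * \<i> * h (circle_through a z x)" for x
    using dist_circle_through[of a z x] assms by (cases "circle_through a z x = a") auto
  then have "contour_integral (circle_through a z) (\<lambda>w. h w / (w - a))
      = integral {0..1} (\<lambda>x. 2 * of_real pi * \<i> * h (circle_through a z x))"
    by (simp add: contour_integral_integral vector_derivative_at[OF has_vector_derivative_circle_through])
  then show ?thesis
    by (simp add: circle_mean_def)
qed

lemma homotopic_loops_circle_through: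
  assumes "closed_annulus a s r \<subseteq> S" and z: "z \<in> closed_annulus a s r" and w: "w \<in> closed_annulus a s r"
  shows "homotopic_loops S (circle_through a z) (circle_through a w)"
proof -
  have "path_connected {u. s \<le> norm (u - a) \<and> norm (u - a) \<le> r}"
    by (rule path_connected_annulus) simp
  then have "path_connected (closed_annulus a s r)"
    by (simp add: closed_annulus_def dist_norm norm_minus_commute)
  then obtain \<gamma> where \<gamma>: "path \<gamma>" "path_image \<gamma> \<subseteq> closed_annulus a s r" "pathstart \<gamma> = z" "pathfinish \<gamma> = w"
    using z w unfolding path_connected_def by blast
  define H where "H p = circle_through a (\<gamma> (fst p)) (snd p)" for p
  have "continuous_on ({0..1} \<times> {0..1}) H"
    unfolding H_def circle_through_def using \<gamma>(1) unfolding path_def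
    by (intro continuous_intros continuous_on_compose2[of "{0..1}" \<gamma> _ fst]) auto
  moreover have "H ` ({0..1} \<times> {0..1}) \<subseteq> S"
  proof -
    have "H (t, x) \<in> closed_annulus a s r" if "t \<in> {0..1}" for t x
      using subsetD[OF \<gamma>(2) imageI[OF that, of \<gamma>, folded path_image_def]] by (simp add: H_def)
    then show ?thesis
      using assms(1) by auto
  qed
  moreover have "H (0, x) = circle_through a z x" "H (1, x) = circle_through a w x" for x
    using \<gamma>(3,4) by (simp_all add: H_def pathstart_def pathfinish_def)
  moreover have "pathfinish (H \<circ> Pair t) = pathstart (H \<circ> Pair t)" for t
    by (simp add: H_def pathstart_def pathfinish_def circle_through_def)
  ultimately show ?thesis
    unfolding homotopic_loops by (intro exI[of _ H]) auto
qed

lemma circle_mean_const_on_annulus: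
  assumes "open S" and h: "h holomorphic_on S" and "closed_annulus a s r \<subseteq> S" and "0 < s"
    and "z \<in> closed_annulus a s r" "w \<in> closed_annulus a s r"
  shows "circle_mean h a z = circle_mean h a w"
proof -
  have "homotopic_loops (S - {a}) (circle_through a z) (circle_through a w)"
    using assms by (intro homotopic_loops_circle_through[of a s r]) auto
  moreover have "(\<lambda>u. h u / (u - a)) holomorphic_on S - {a}"
    using h by (auto intro!: holomorphic_intros intro: holomorphic_on_subset)
  ultimately have "contour_integral (circle_through a z) (\<lambda>u. h u / (u - a))
      = contour_integral (circle_through a w) (\<lambda>u. h u / (u - a))"
    using \<open>open S\<close> by (intro Cauchy_theorem_homotopic_loops[of "S - {a}"] valid_path_circle_through) auto
  moreover have "z \<noteq> a" "w \<noteq> a"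
    using assms by auto
  ultimately show ?thesis
    by (simp add: circle_mean_eq_contour_integral)
qed

lemma circle_mean_Cauchy:
  assumes f: "f holomorphic_on ball a d" and z: "dist a z < dist a v" and v: "dist a v < d"
  shows "circle_mean (\<lambda>w. f w * (w - a) / (w - z)) a v = f z"
proof -
  define u where "u = a + of_real (dist a v)"
  have u: "dist a u = dist a v" "u \<noteq> a"
    using z by (auto simp: u_def dist_norm)
  have "circle_mean (\<lambda>w. f w * (w - a) / (w - z)) a v = circle_mean (\<lambda>w. f w * (w - a) / (w - z)) a u"
  proof (rule circle_mean_const_on_annulus)
    show "(\<lambda>w. f w * (w - a) / (w - z)) holomorphic_on ball a d - {z}"
      using f by (auto intro!: holomorphic_intros intro: holomorphic_on_subset)
    show "closed_annulus a (dist a v) (dist a v) \<subseteq> ball a d - {z}"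
      using z v by auto
  qed (use z u in \<open>auto intro: le_less_trans[OF zero_le_dist]\<close>)
  also have "\<dots> = contour_integral (circlepath a (dist a v)) (\<lambda>w. f w * (w - a) / (w - z) / (w - a))
      / (2 * of_real pi * \<i>)"
    using u(2) by (simp add: circle_mean_eq_contour_integral circlepath_eq_circle_through u_def)
  also have "contour_integral (circlepath a (dist a v)) (\<lambda>w. f w * (w - a) / (w - z) / (w - a))
      = contour_integral (circlepath a (dist a v)) (\<lambda>w. f w / (w - z))"
    by (rule contour_integral_cong) (use z in auto)
  also have "\<dots> = 2 * of_real pi * \<i> * f z"
    using f z v
    by (intro contour_integral_unique Cauchy_integral_circlepath_simple)
       (auto simp: dist_norm norm_minus_commute elim!: holomorphic_on_subset)
  finally show ?thesis
    by simp
qed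

lemma circle_mean_holomorphic:
  assumes "f holomorphic_on ball a d" and "dist a v < d"
  shows "circle_mean f a v = f a"
proof (cases "v = a")
  case True
  then show ?thesis
    by (simp add: circle_mean_def circle_through_def)
next
  case False
  then have "circle_mean f a v = circle_mean (\<lambda>w. f w * (w - a) / (w - a)) a v"
    by (intro circle_mean_cong) auto
  also have "\<dots> = f a"
    using assms False by (intro circle_mean_Cauchy) auto
  finally show ?thesis .
qed

lemma circle_mean_difference_quotient:
  assumes "continuous_on (sphere a (dist a y)) h" and "dist a y \<noteq> dist a z"
  shows "circle_mean (\<lambda>w. (h w - b) / (w - z) * (w - a)) a y
    = circle_mean (\<lambda>w. h w * (w - a) / (w - z)) a y - b * circle_mean (\<lambda>w. 1 * (w - a) / (w - z)) a y"
proof -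
  have "circle_mean (\<lambda>w. (h w - b) / (w - z) * (w - a)) a y
      = circle_mean (\<lambda>w. h w * (w - a) / (w - z) - b * (1 * (w - a) / (w - z))) a y"
    by (simp add: diff_divide_distrib add_divide_distrib algebra_simps)
  also have "\<dots> = circle_mean (\<lambda>w. h w * (w - a) / (w - z)) a y
      - circle_mean (\<lambda>w. b * (1 * (w - a) / (w - z))) a y"
    using assms by (intro circle_mean_diff continuous_intros) auto
  finally show ?thesis
    by (simp only: circle_mean_cmult)
qed

lemma circle_mean_Cauchy_annulus:
  assumes "open S" and h: "h holomorphic_on S" and A: "closed_annulus a (dist a v) (dist a u) \<subseteq> S"
    and "v \<noteq> a" and z: "dist a v < dist a z" "dist a z < dist a u"
  shows "h z = circle_mean (\<lambda>w. h w * (w - a) / (w - z)) a u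
    - circle_mean (\<lambda>w. h w * (w - a) / (w - z)) a v"
proof -
  define g where "g w = (if w = z then deriv h z else (h w - h z) / (w - z))" for w
  have "g holomorphic_on S"
    unfolding g_def using h \<open>open S\<close> by (rule pole_lemma_open)
  then have "(\<lambda>w. g w * (w - a)) holomorphic_on S"
    by (intro holomorphic_intros)
  then have "circle_mean (\<lambda>w. g w * (w - a)) a u = circle_mean (\<lambda>w. g w * (w - a)) a v"
    using assms by (intro circle_mean_const_on_annulus[of S _ a "dist a v" "dist a u"]) auto
  moreover have "circle_mean (\<lambda>w. g w * (w - a)) a y
      = circle_mean (\<lambda>w. h w * (w - a) / (w - z)) a y - h z * circle_mean (\<lambda>w. 1 * (w - a) / (w - z)) a y"
    if "y \<in> closed_annulus a (dist a v) (dist a u)" "dist a y \<noteq> dist a z" for y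
  proof -
    have "sphere a (dist a y) \<subseteq> S"
      using that A by auto
    then have h_cont: "continuous_on (sphere a (dist a y)) h"
      using h holomorphic_on_imp_continuous_on continuous_on_subset by blast
    have "circle_mean (\<lambda>w. g w * (w - a)) a y = circle_mean (\<lambda>w. (h w - h z) / (w - z) * (w - a)) a y"
      using that by (intro circle_mean_cong) (auto simp: g_def)
    also have "\<dots> = circle_mean (\<lambda>w. h w * (w - a) / (w - z)) a y
        - h z * circle_mean (\<lambda>w. 1 * (w - a) / (w - z)) a y"
      using h_cont that(2) by (rule circle_mean_difference_quotient)
    finally show ?thesis .
  qed
  moreover have "circle_mean (\<lambda>w. 1 * (w - a) / (w - z)) a u = 1"
    using z by (intro circle_mean_Cauchy[where d = "dist a u + 1"]) auto
  moreover have "circle_mean (\<lambda>w. 1 * (w - a) / (w - z)) a v = 1 * (a - a) / (a - z)"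
    using z by (intro circle_mean_holomorphic[where d = "dist a z"]) (auto intro!: holomorphic_intros)
  ultimately show ?thesis
    using z by (simp add: diff_eq_eq)
qed

text \<open>On the outer circle \<open>(w - a) / (w - z) = 1 + (z - a) / (w - z)\<close>, so that the outer mean in
  Cauchy's formula splits off the mean of \<open>h\<close>, the residue term.\<close>

lemma diff_circle_mean_eq:
  assumes "open S" and h: "h holomorphic_on S" and A: "closed_annulus a (dist a v) (dist a u) \<subseteq> S"
    and "v \<noteq> a" and z: "dist a v < dist a z" "dist a z < dist a u"
  shows "h z - circle_mean h a u
    = (z - a) * circle_mean (\<lambda>w. h w / (w - z)) a u - circle_mean (\<lambda>w. h w * (w - a) / (w - z)) a v"
proof -
  have "sphere a (dist a u) \<subseteq> S"
    using A z by auto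
  then have h_cont: "continuous_on (sphere a (dist a u)) h"
    using h holomorphic_on_imp_continuous_on continuous_on_subset by blast
  have "circle_mean (\<lambda>w. h w * (w - a) / (w - z)) a u
      = circle_mean (\<lambda>w. h w + (z - a) * (h w / (w - z))) a u"
  proof (rule circle_mean_cong)
    fix w assume "dist a w = dist a u"
    then have "w - z \<noteq> 0"
      using z by auto
    then show "h w * (w - a) / (w - z) = h w + (z - a) * (h w / (w - z))"
      by (simp add: divide_simps) (simp add: algebra_simps)
  qed
  also have "\<dots> = circle_mean h a u + (z - a) * circle_mean (\<lambda>w. h w / (w - z)) a u"
    using z h_cont by (subst circle_mean_add) (auto intro!: continuous_intros simp flip: circle_mean_cmult)
  finally show ?thesis
    using circle_mean_Cauchy_annulus[OF assms] by simp
qed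

lemma norm_diff_circle_mean_le:
  assumes "open S" and h: "h holomorphic_on S" and A: "closed_annulus a (dist a v) (dist a u) \<subseteq> S"
    and "v \<noteq> a" and z: "dist a v < dist a z" "dist a z < dist a u"
    and B: "\<And>w. dist a w = dist a u \<Longrightarrow> cmod (h w) \<le> B" and B': "\<And>w. dist a w = dist a v \<Longrightarrow> cmod (h w) \<le> B'"
  shows "cmod (h z - circle_mean h a u)
    \<le> dist a z * (B / (dist a u - dist a z)) + B' * dist a v / (dist a z - dist a v)"
proof -
  have "sphere a (dist a u) \<subseteq> S" "sphere a (dist a v) \<subseteq> S"
    using A z by auto
  then have h_cont: "continuous_on (sphere a (dist a u)) h" "continuous_on (sphere a (dist a v)) h"
    using h holomorphic_on_imp_continuous_on continuous_on_subset by blast+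
  have "0 \<le> B" "0 \<le> B'"
    using B[of u] B'[of v] by (auto intro: order_trans[OF norm_ge_zero])
  have "cmod (h z - circle_mean h a u)
      \<le> dist a z * cmod (circle_mean (\<lambda>w. h w / (w - z)) a u)
        + cmod (circle_mean (\<lambda>w. h w * (w - a) / (w - z)) a v)"
    unfolding diff_circle_mean_eq[OF assms(1-6)]
    by (rule order_trans[OF norm_triangle_ineq4]) (simp add: norm_mult dist_norm norm_minus_commute)
  also have "\<dots> \<le> dist a z * (B / (dist a u - dist a z)) + B' * dist a v / (dist a z - dist a v)"
  proof (intro add_mono mult_left_mono norm_circle_mean_le)
    show "continuous_on (sphere a (dist a u)) (\<lambda>w. h w / (w - z))"
      using z by (intro continuous_intros h_cont) auto
    show "continuous_on (sphere a (dist a v)) (\<lambda>w. h w * (w - a) / (w - z))"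
      using z by (intro continuous_intros h_cont) auto
  next
    fix w assume w: "dist a w = dist a u"
    then have "dist a u - dist a z \<le> cmod (w - z)"
      using dist_triangle[of a w z] by (simp add: dist_norm norm_minus_commute)
    then show "cmod (h w / (w - z)) \<le> B / (dist a u - dist a z)"
      unfolding norm_divide using B[OF w] z \<open>0 \<le> B\<close> by (intro frac_le) auto
  next
    fix w assume w: "dist a w = dist a v"
    then have "dist a z - dist a v \<le> cmod (w - z)"
      using dist_triangle[of a z w] by (simp add: dist_norm norm_minus_commute)
    moreover have "cmod (h w) * cmod (w - a) \<le> B' * dist a v"
      using B'[OF w] w by (simp add: dist_norm norm_minus_commute mult_right_mono)
    ultimately show "cmod (h w * (w - a) / (w - z)) \<le> B' * dist a v / (dist a z - dist a v)"
      unfolding norm_divide norm_mult using z \<open>0 \<le> B'\<close> by (intro frac_le) auto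
  qed simp
  finally show ?thesis .
qed

lemma borel_measurable_circle_through [measurable]: "(\<lambda>z. circle_through a z x) \<in> borel_measurable borel"
proof -
  have "continuous_on UNIV (\<lambda>z. circle_through a z x)"
    unfolding circle_through_def by (intro continuous_intros)
  then show ?thesis
    by (rule borel_measurable_continuous_onI)
qed

lemma distr_lborel_circle_through: "distr lborel borel (\<lambda>z. circle_through a z x) = lborel"
proof (rule distr_lborel_isometry)
  have "w = circle_through a (circle_through a w (- x)) x" for w
    by (simp add: circle_through_def cis_mult flip: mult.assoc)
  then show "surj (\<lambda>z. circle_through a z x)"
    by (rule surjI[OF sym])
  show "dist (circle_through a y x) (circle_through a z x) = dist y z" for y z
    by (simp add: circle_through_def dist_norm norm_mult flip: right_diff_distrib)
qed

lemma nn_integral_circle_average: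
  fixes F :: "complex \<Rightarrow> ennreal"
  assumes [measurable]: "F \<in> borel_measurable borel"
  shows "(\<integral>\<^sup>+z. F z \<partial>lborel) = (\<integral>\<^sup>+z. (\<integral>\<^sup>+x\<in>{0..1}. F (circle_through a z x) \<partial>lborel) \<partial>lborel)"
proof -
  have rotation: "(\<integral>\<^sup>+z. F (circle_through a z x) \<partial>lborel) = (\<integral>\<^sup>+z. F z \<partial>lborel)" for x
  proof -
    have "(\<integral>\<^sup>+z. F z \<partial>lborel) = (\<integral>\<^sup>+z. F z \<partial>distr lborel borel (\<lambda>z. circle_through a z x))"
      by (simp add: distr_lborel_circle_through)
    also have "\<dots> = (\<integral>\<^sup>+z. F (circle_through a z x) \<partial>lborel)"
      by (rule nn_integral_distr) measurable
    finally show ?thesis ..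
  qed
  have "continuous_on UNIV (\<lambda>p. circle_through a (fst p) (snd p))"
    unfolding circle_through_def by (intro continuous_intros)
  then have "(\<lambda>p. circle_through a (fst p) (snd p)) \<in> borel_measurable borel"
    by (rule borel_measurable_continuous_onI)
  then have [measurable]:
    "(\<lambda>p. F (circle_through a (fst p) (snd p))) \<in> borel_measurable (lborel \<Otimes>\<^sub>M lborel)"
    using measurable_compose[OF _ assms] by (simp add: lborel_prod)
  have "(\<integral>\<^sup>+z. (\<integral>\<^sup>+x\<in>{0..1}. F (circle_through a z x) \<partial>lborel) \<partial>lborel)
      = (\<integral>\<^sup>+x. (\<integral>\<^sup>+z. F (circle_through a z x) * indicator {0..1} x \<partial>lborel) \<partial>lborel)"
    by (rule lborel_pair.Fubini'[symmetric]) (unfold case_prod_unfold, measurable)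
  also have "\<dots> = (\<integral>\<^sup>+x. (\<integral>\<^sup>+z. F z \<partial>lborel) * indicator {0..1::real} x \<partial>lborel)"
  proof (intro nn_integral_cong)
    fix x :: real
    show "(\<integral>\<^sup>+z. F (circle_through a z x) * indicator {0..1} x \<partial>lborel)
        = (\<integral>\<^sup>+z. F z \<partial>lborel) * indicator {0..1} x"
      by (cases "x \<in> {0..1}") (simp_all add: rotation)
  qed
  also have "\<dots> = (\<integral>\<^sup>+z. F z \<partial>lborel)"
    by (subst nn_integral_cmult_indicator) auto
  finally show ?thesis
    by simp
qed

lemma power2_norm_integral_le:
  fixes g :: "real \<Rightarrow> 'a::euclidean_space"
  assumes "continuous_on {a..b} g" and "a \<le> b"
  shows "ennreal ((norm (integral {a..b} g))\<^sup>2)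
    \<le> ennreal (b - a) * (\<integral>\<^sup>+x\<in>{a..b}. ennreal ((norm (g x))\<^sup>2) \<partial>lborel)"
proof -
  define G where "G x = indicator {a..b} x *\<^sub>R g x" for x
  have g: "set_integrable lborel {a..b} g"
    using assms(1) by (rule borel_integrable_atLeastAtMost')
  then have G: "integrable lborel G"
    unfolding set_integrable_def G_def .
  then have [measurable]: "G \<in> borel_measurable borel"
    using borel_measurable_integrable[OF G] by simp
  have "integral {a..b} g = integral\<^sup>L lborel G"
    using set_borel_integral_eq_integral(2)[OF g] unfolding set_lebesgue_integral_def G_def ..
  then have "ennreal (norm (integral {a..b} g)) \<le> (\<integral>\<^sup>+x. ennreal (norm (G x)) \<partial>lborel)"
    using integral_norm_bound_ennreal[OF G] by simp
  also have "\<dots> = (\<integral>\<^sup>+x. ennreal (norm (G x)) * indicator {a..b} x \<partial>lborel)"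
    by (intro nn_integral_cong) (simp add: G_def indicator_def)
  finally have "(ennreal (norm (integral {a..b} g)))\<^sup>2
      \<le> (\<integral>\<^sup>+x. ennreal (norm (G x)) * indicator {a..b} x \<partial>lborel)\<^sup>2"
    by (rule power_mono) simp
  also have "\<dots> \<le> (\<integral>\<^sup>+x. (ennreal (norm (G x)))\<^sup>2 \<partial>lborel) * (\<integral>\<^sup>+x. (indicator {a..b} x)\<^sup>2 \<partial>lborel)"
    by (rule Cauchy_Schwarz_nn_integral) measurable
  also have "(\<integral>\<^sup>+x. (indicator {a..b} x)\<^sup>2 \<partial>lborel) = ennreal (b - a)"
  proof -
    have "(\<integral>\<^sup>+x. (indicator {a..b} x)\<^sup>2 \<partial>lborel) = (\<integral>\<^sup>+x. indicator {a..b} x \<partial>lborel)"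
      by (intro nn_integral_cong) (simp add: indicator_def)
    with \<open>a \<le> b\<close> show ?thesis
      by simp
  qed
  also have "(\<integral>\<^sup>+x. (ennreal (norm (G x)))\<^sup>2 \<partial>lborel) = (\<integral>\<^sup>+x\<in>{a..b}. ennreal ((norm (g x))\<^sup>2) \<partial>lborel)"
    by (intro nn_integral_cong) (auto simp: G_def indicator_def ennreal_power)
  finally show ?thesis
    by (simp add: ennreal_power mult.commute)
qed

lemma power2_circle_mean_le:
  assumes "continuous_on (sphere a (dist a z)) h"
  shows "ennreal ((cmod (circle_mean h a z))\<^sup>2)
    \<le> (\<integral>\<^sup>+x\<in>{0..1}. ennreal ((cmod (h (circle_through a z x)))\<^sup>2) \<partial>lborel)"
  using power2_norm_integral_le[OF continuous_on_compose_circle_through[OF assms], of 0 1]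
  by (simp add: circle_mean_def)

lemma nn_integral_circle_mean_le:
  fixes w :: "real \<Rightarrow> real"
  assumes [measurable]: "U \<in> sets borel" "w \<in> borel_measurable borel" and w_nonneg: "\<And>t. 0 \<le> w t"
    and h: "continuous_on U h" and U: "\<And>z. z \<in> U \<Longrightarrow> sphere a (dist a z) \<subseteq> U"
  shows "(\<integral>\<^sup>+z\<in>U. ennreal (w (dist a z) * (cmod (circle_mean h a z))\<^sup>2) \<partial>lborel)
    \<le> (\<integral>\<^sup>+z\<in>U. ennreal (w (dist a z) * (cmod (h z))\<^sup>2) \<partial>lborel)"
proof -
  define H where "H z = ennreal (indicator U z *\<^sub>R (cmod (h z))\<^sup>2)" for z
  have "(\<lambda>z. indicator U z *\<^sub>R (cmod (h z))\<^sup>2) \<in> borel_measurable borel"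
    using h by (intro borel_measurable_continuous_on_indicator continuous_intros) auto
  then have [measurable]: "H \<in> borel_measurable borel"
    unfolding H_def by (rule measurable_compose[OF _ measurable_ennreal])
  have [measurable]: "circle_through a z \<in> borel_measurable borel" for z
    by (intro borel_measurable_continuous_onI continuous_on_circle_through)
  have mean_le: "ennreal (w (dist a z) * (cmod (circle_mean h a z))\<^sup>2)
      \<le> (\<integral>\<^sup>+x\<in>{0..1}. ennreal (w (dist a z)) * H (circle_through a z x) \<partial>lborel)" if "z \<in> U" for z
  proof -
    have "circle_through a z x \<in> U" for x
      using U[OF that] by auto
    then have "ennreal ((cmod (circle_mean h a z))\<^sup>2) \<le> (\<integral>\<^sup>+x\<in>{0..1}. H (circle_through a z x) \<partial>lborel)"
      using power2_circle_mean_le[OF continuous_on_subset[OF h U[OF that]]] by (simp add: H_def)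
    then have "ennreal (w (dist a z) * (cmod (circle_mean h a z))\<^sup>2)
        \<le> ennreal (w (dist a z)) * (\<integral>\<^sup>+x\<in>{0..1}. H (circle_through a z x) \<partial>lborel)"
      by (simp add: ennreal_mult w_nonneg mult_left_mono)
    also have "\<dots> = (\<integral>\<^sup>+x\<in>{0..1}. ennreal (w (dist a z)) * H (circle_through a z x) \<partial>lborel)"
      by (subst nn_integral_cmult[symmetric]) (simp_all add: mult.assoc)
    finally show ?thesis .
  qed
  have "(\<integral>\<^sup>+z\<in>U. ennreal (w (dist a z) * (cmod (circle_mean h a z))\<^sup>2) \<partial>lborel)
      \<le> (\<integral>\<^sup>+z. (\<integral>\<^sup>+x\<in>{0..1}. ennreal (w (dist a z)) * H (circle_through a z x) \<partial>lborel) \<partial>lborel)"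
    by (intro nn_integral_mono) (simp add: mean_le split: split_indicator)
  also have "\<dots> = (\<integral>\<^sup>+z. ennreal (w (dist a z)) * H z \<partial>lborel)"
    using nn_integral_circle_average[of "\<lambda>z. ennreal (w (dist a z)) * H z" a] by simp
  also have "\<dots> = (\<integral>\<^sup>+z\<in>U. ennreal (w (dist a z) * (cmod (h z))\<^sup>2) \<partial>lborel)"
    by (intro nn_integral_cong) (auto simp: H_def ennreal_mult w_nonneg split: split_indicator)
  finally show ?thesis .
qed

lemma power2_norm_center_le_nn_integral_ball:
  assumes f: "f holomorphic_on ball a d" and "0 \<le> d"
  shows "ennreal (pi * d\<^sup>2 * (cmod (f a))\<^sup>2) \<le> (\<integral>\<^sup>+z\<in>ball a d. ennreal ((cmod (f z))\<^sup>2) \<partial>lborel)"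
proof -
  have "ennreal (pi * d\<^sup>2 * (cmod (f a))\<^sup>2) = (\<integral>\<^sup>+z\<in>ball a d. ennreal ((cmod (f a))\<^sup>2) \<partial>lborel)"
    using \<open>0 \<le> d\<close> by (subst nn_integral_cmult_indicator)
      (simp_all add: emeasure_ball unit_ball_vol_2 mult.commute flip: ennreal_mult)
  also have "\<dots> = (\<integral>\<^sup>+z\<in>ball a d. ennreal (1 * (cmod (circle_mean f a z))\<^sup>2) \<partial>lborel)"
    by (intro nn_integral_cong) (auto simp: indicator_def circle_mean_holomorphic[OF f])
  also have "\<dots> \<le> (\<integral>\<^sup>+z\<in>ball a d. ennreal (1 * (cmod (f z))\<^sup>2) \<partial>lborel)"
    using f by (intro nn_integral_circle_mean_le holomorphic_on_imp_continuous_on) auto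
  finally show ?thesis
    by simp
qed

lemma power2_circle_mean_le_nn_integral_annulus:
  assumes "open S" and f: "f holomorphic_on S" and A: "closed_annulus a s r \<subseteq> S" and "0 < s"
    and u: "u \<in> closed_annulus a s r"
  shows "ennreal (2 * pi * ln (r / s) * (cmod (circle_mean (\<lambda>w. (w - a) * f w) a u))\<^sup>2)
    \<le> (\<integral>\<^sup>+z\<in>closed_annulus a s r. ennreal ((cmod (f z))\<^sup>2) \<partial>lborel)"
proof -
  let ?h = "\<lambda>w. (w - a) * f w"
  have h: "?h holomorphic_on S"
    using f by (intro holomorphic_intros)
  then have h_cont: "continuous_on (closed_annulus a s r) ?h"
    using A holomorphic_on_imp_continuous_on continuous_on_subset by blast
  have "s \<le> r"
    using u by simp
  have "ennreal (2 * pi * ln (r / s) * (cmod (circle_mean ?h a u))\<^sup>2)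
      = (\<integral>\<^sup>+z\<in>closed_annulus a s r. ennreal (1 / (dist a z)\<^sup>2) \<partial>lborel)
        * ennreal ((cmod (circle_mean ?h a u))\<^sup>2)"
    using \<open>0 < s\<close> \<open>s \<le> r\<close> by (subst nn_integral_inverse_square_annulus) (auto simp: ennreal_mult)
  also have "\<dots>
      = (\<integral>\<^sup>+z\<in>closed_annulus a s r. ennreal (1 / (dist a z)\<^sup>2 * (cmod (circle_mean ?h a z))\<^sup>2) \<partial>lborel)"
    using circle_mean_const_on_annulus[OF \<open>open S\<close> h A \<open>0 < s\<close> u]
    by (subst nn_integral_multc[symmetric])
      (auto intro!: nn_integral_cong simp: indicator_def simp flip: ennreal_mult)
  also have "\<dots> \<le> (\<integral>\<^sup>+z\<in>closed_annulus a s r. ennreal (1 / (dist a z)\<^sup>2 * (cmod (?h z))\<^sup>2) \<partial>lborel)"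
    by (rule nn_integral_circle_mean_le[of _ "\<lambda>t. 1 / t\<^sup>2"]) (use h_cont in auto)
  also have "\<dots> = (\<integral>\<^sup>+z\<in>closed_annulus a s r. ennreal ((cmod (f z))\<^sup>2) \<partial>lborel)"
    using \<open>0 < s\<close> by (intro nn_integral_cong)
      (auto simp: indicator_def norm_mult power_mult_distrib dist_norm norm_minus_commute)
  finally show ?thesis .
qed

section \<open>The Bergman space and its kernel\<close>

definition bergman_inner :: "complex set \<Rightarrow> (complex \<Rightarrow> complex) \<Rightarrow> (complex \<Rightarrow> complex) \<Rightarrow> complex" where
  "bergman_inner \<Omega> f g = (LINT z:\<Omega>|lborel. f z * cnj (g z))"

definition bergman_norm :: "complex set \<Rightarrow> (complex \<Rightarrow> complex) \<Rightarrow> real" where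
  "bergman_norm \<Omega> f = sqrt (LINT z:\<Omega>|lborel. (cmod (f z))\<^sup>2)"

lemma bergman_norm_power2: "(bergman_norm \<Omega> f)\<^sup>2 = (LINT z:\<Omega>|lborel. (cmod (f z))\<^sup>2)"
  unfolding bergman_norm_def set_lebesgue_integral_def by (intro real_sqrt_pow2 integral_nonneg_AE) auto

lemma bergman_norm_nonneg [simp]: "0 \<le> bergman_norm \<Omega> f"
  unfolding bergman_norm_def set_lebesgue_integral_def by (intro real_sqrt_ge_zero integral_nonneg_AE) auto

lemma bergman_inner_self: "bergman_inner \<Omega> f f = of_real ((bergman_norm \<Omega> f)\<^sup>2)"
proof -
  have "bergman_inner \<Omega> f f = (LINT z|lborel. complex_of_real (indicator \<Omega> z *\<^sub>R (cmod (f z))\<^sup>2))"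
    unfolding bergman_inner_def set_lebesgue_integral_def
    by (intro Bochner_Integration.integral_cong) (auto simp: complex_norm_square[symmetric] indicator_def)
  then show ?thesis
    by (simp only: integral_complex_of_real bergman_norm_power2 set_lebesgue_integral_def)
qed

lemma bergman_inner_commute: "bergman_inner \<Omega> g f = cnj (bergman_inner \<Omega> f g)"
proof -
  have "bergman_inner \<Omega> g f = (LINT z|lborel. cnj (indicator \<Omega> z *\<^sub>R (f z * cnj (g z))))"
    unfolding bergman_inner_def set_lebesgue_integral_def
    by (intro Bochner_Integration.integral_cong) (auto simp: indicator_def)
  then show ?thesis
    by (simp only: Bochner_Integration.integral_cnj bergman_inner_def set_lebesgue_integral_def)
qed

lemma bergman_inner_cong:
  assumes "\<And>z. z \<in> \<Omega> \<Longrightarrow> f z = f' z" "\<And>z. z \<in> \<Omega> \<Longrightarrow> g z = g' z"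
  shows "bergman_inner \<Omega> f g = bergman_inner \<Omega> f' g'"
  unfolding bergman_inner_def set_lebesgue_integral_def
  using assms by (intro Bochner_Integration.integral_cong) (auto simp: indicator_def)

lemma bergman_space_cong:
  assumes eq: "\<And>z. z \<in> \<Omega> \<Longrightarrow> f z = g z"
  shows "f \<in> bergman_space \<Omega> \<longleftrightarrow> g \<in> bergman_space \<Omega>"
proof -
  have "(\<lambda>z. indicator \<Omega> z *\<^sub>R (cmod (f z))\<^sup>2) = (\<lambda>z. indicator \<Omega> z *\<^sub>R (cmod (g z))\<^sup>2)"
    using eq by (auto simp: indicator_def)
  moreover have "f holomorphic_on \<Omega> \<longleftrightarrow> g holomorphic_on \<Omega>"
    using eq by (intro holomorphic_cong) auto
  ultimately show ?thesis
    by (simp add: bergman_space_def set_integrable_def)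
qed

lemma bergman_space_imp_holomorphic: "f \<in> bergman_space \<Omega> \<Longrightarrow> f holomorphic_on \<Omega>"
  by (simp add: bergman_space_def)

lemma bergman_space_imp_continuous: "f \<in> bergman_space \<Omega> \<Longrightarrow> continuous_on \<Omega> f"
  by (rule holomorphic_on_imp_continuous_on[OF bergman_space_imp_holomorphic])

lemma zero_in_bergman_space [simp]: "(\<lambda>z. 0) \<in> bergman_space \<Omega>"
  by (simp add: bergman_space_def set_integrable_def)

lemma nn_integral_bergman_space:
  assumes "f \<in> bergman_space \<Omega>"
  shows "(\<integral>\<^sup>+z\<in>\<Omega>. ennreal ((cmod (f z))\<^sup>2) \<partial>lborel) = ennreal ((bergman_norm \<Omega> f)\<^sup>2)"
proof -
  have "(\<integral>\<^sup>+z\<in>\<Omega>. ennreal ((cmod (f z))\<^sup>2) \<partial>lborel)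
      = (\<integral>\<^sup>+z. ennreal (indicator \<Omega> z *\<^sub>R (cmod (f z))\<^sup>2) \<partial>lborel)"
    by (intro nn_integral_cong) (auto simp: indicator_def)
  also have "\<dots> = ennreal ((bergman_norm \<Omega> f)\<^sup>2)"
    using assms unfolding bergman_norm_power2 bergman_space_def set_integrable_def set_lebesgue_integral_def
    by (intro nn_integral_eq_integral) auto
  finally show ?thesis .
qed

lemma power2_norm_le_bergman_norm:
  assumes f: "f \<in> bergman_space \<Omega>" and d: "0 \<le> d" "ball w d \<subseteq> \<Omega>"
  shows "pi * d\<^sup>2 * (cmod (f w))\<^sup>2 \<le> (bergman_norm \<Omega> f)\<^sup>2"
proof -
  have "f holomorphic_on ball w d"
    using bergman_space_imp_holomorphic[OF f] d(2) by (rule holomorphic_on_subset)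
  then have "ennreal (pi * d\<^sup>2 * (cmod (f w))\<^sup>2) \<le> (\<integral>\<^sup>+z\<in>ball w d. ennreal ((cmod (f z))\<^sup>2) \<partial>lborel)"
    using d(1) by (rule power2_norm_center_le_nn_integral_ball)
  also have "\<dots> \<le> (\<integral>\<^sup>+z\<in>\<Omega>. ennreal ((cmod (f z))\<^sup>2) \<partial>lborel)"
    using d(2) by (intro nn_integral_mono) (auto simp: indicator_def)
  finally show ?thesis
    by (simp add: nn_integral_bergman_space[OF f])
qed

lemma norm_le_bergman_norm:
  assumes "f \<in> bergman_space \<Omega>" "0 < d" "ball w d \<subseteq> \<Omega>"
  shows "cmod (f w) \<le> bergman_norm \<Omega> f / d"
proof -
  have "1 * (d * cmod (f w))\<^sup>2 \<le> pi * (d * cmod (f w))\<^sup>2"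
    using pi_gt3 by (intro mult_right_mono) auto
  also have "\<dots> \<le> (bergman_norm \<Omega> f)\<^sup>2"
    using power2_norm_le_bergman_norm[of f \<Omega> d w] assms by (simp add: power_mult_distrib mult.assoc)
  finally have "d * cmod (f w) \<le> bergman_norm \<Omega> f"
    using \<open>0 < d\<close> by (simp add: power2_le_iff_abs_le abs_mult)
  then show ?thesis
    using \<open>0 < d\<close> by (simp add: field_simps)
qed

lemma minimising_sequence_exists:
  fixes f :: "'a \<Rightarrow> real"
  assumes "S \<noteq> {}" and "bdd_below (f ` S)"
  obtains F where "\<And>n. F n \<in> S" "\<And>n. f (F n) < (INF x\<in>S. f x) + 1 / real (Suc n)"
proof -
  have "\<exists>x\<in>S. f x < (INF x\<in>S. f x) + 1 / real (Suc n)" for n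
    using cINF_less_iff[OF assms, THEN iffD1] by simp
  then show thesis
    using that by metis
qed

definition bergman_reproducing :: "complex set \<Rightarrow> complex \<Rightarrow> (complex \<Rightarrow> complex) \<Rightarrow> bool" where
  "bergman_reproducing \<Omega> w k \<longleftrightarrow>
     k \<in> bergman_space \<Omega> \<and> (\<forall>f\<in>bergman_space \<Omega>. f w = bergman_inner \<Omega> f k)"

context
  fixes \<Omega> :: "complex set"
  assumes open_\<Omega>: "open \<Omega>"
begin

lemma bergman_norm_eq_0_imp_zero:
  assumes "f \<in> bergman_space \<Omega>" "bergman_norm \<Omega> f = 0" "w \<in> \<Omega>"
  shows "f w = 0"
proof -
  obtain d where "0 < d" "ball w d \<subseteq> \<Omega>"
    using open_\<Omega> \<open>w \<in> \<Omega>\<close> openE by blast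
  then show ?thesis
    using norm_le_bergman_norm[OF assms(1)] assms(2) by fastforce
qed

lemma borel_measurable_indicator_scaleR:
  fixes h :: "complex \<Rightarrow> 'b::real_normed_vector"
  assumes "continuous_on \<Omega> h"
  shows "(\<lambda>z. indicator \<Omega> z *\<^sub>R h z) \<in> borel_measurable borel"
  using open_\<Omega> assms by (intro borel_measurable_continuous_on_indicator) auto

lemma bergman_spaceI:
  assumes "f holomorphic_on \<Omega>" and "0 \<le> B"
    and le: "(\<integral>\<^sup>+z\<in>\<Omega>. ennreal ((cmod (f z))\<^sup>2) \<partial>lborel) \<le> ennreal (B\<^sup>2)"
  shows "f \<in> bergman_space \<Omega>" "bergman_norm \<Omega> f \<le> B"
proof -
  have "continuous_on \<Omega> (\<lambda>z. (cmod (f z))\<^sup>2)"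
    using assms(1) by (intro continuous_intros holomorphic_on_imp_continuous_on)
  then have "(\<lambda>z. indicator \<Omega> z *\<^sub>R (cmod (f z))\<^sup>2) \<in> borel_measurable lborel"
    using borel_measurable_indicator_scaleR by (simp del: real_scaleR_def)
  moreover have "(\<integral>\<^sup>+z. ennreal (norm (indicator \<Omega> z *\<^sub>R (cmod (f z))\<^sup>2)) \<partial>lborel) < \<infinity>"
  proof -
    have "(\<integral>\<^sup>+z. ennreal (norm (indicator \<Omega> z *\<^sub>R (cmod (f z))\<^sup>2)) \<partial>lborel)
        = (\<integral>\<^sup>+z\<in>\<Omega>. ennreal ((cmod (f z))\<^sup>2) \<partial>lborel)"
      by (intro nn_integral_cong) (auto simp: indicator_def)
    also have "\<dots> < \<infinity>"
      using le by (auto simp: less_top[symmetric] top_unique)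
    finally show ?thesis .
  qed
  ultimately show f: "f \<in> bergman_space \<Omega>"
    using assms(1) by (simp add: bergman_space_def set_integrable_def integrableI_bounded)
  show "bergman_norm \<Omega> f \<le> B"
    using le \<open>0 \<le> B\<close> unfolding nn_integral_bergman_space[OF f] by (simp add: power2_le_iff_abs_le)
qed

lemma set_integrable_bergman_bound:
  fixes h :: "complex \<Rightarrow> 'b::{banach, second_countable_topology}"
  assumes f: "f \<in> bergman_space \<Omega>" and g: "g \<in> bergman_space \<Omega>" and h: "continuous_on \<Omega> h"
    and bound: "\<And>z. z \<in> \<Omega> \<Longrightarrow> norm (h z) \<le> C * ((cmod (f z))\<^sup>2 + (cmod (g z))\<^sup>2)"
  shows "set_integrable lborel \<Omega> h"
  unfolding set_integrable_def
proof (rule Bochner_Integration.integrable_bound)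
  have "set_integrable lborel \<Omega> (\<lambda>z. C * ((cmod (f z))\<^sup>2 + (cmod (g z))\<^sup>2))"
    using f g by (intro set_integrable_mult_right set_integral_add(1)) (auto simp: bergman_space_def)
  then show "integrable lborel (\<lambda>z. indicator \<Omega> z *\<^sub>R (C * ((cmod (f z))\<^sup>2 + (cmod (g z))\<^sup>2)))"
    by (simp only: set_integrable_def)
  show "(\<lambda>z. indicator \<Omega> z *\<^sub>R h z) \<in> borel_measurable lborel"
    using borel_measurable_indicator_scaleR[OF h] by simp
  show "AE z in lborel. norm (indicator \<Omega> z *\<^sub>R h z)
      \<le> norm (indicator \<Omega> z *\<^sub>R (C * ((cmod (f z))\<^sup>2 + (cmod (g z))\<^sup>2)))"
  proof (rule AE_I2)
    fix z
    show "norm (indicator \<Omega> z *\<^sub>R h z) \<le> norm (indicator \<Omega> z *\<^sub>R (C * ((cmod (f z))\<^sup>2 + (cmod (g z))\<^sup>2)))"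
      using order_trans[OF bound abs_ge_self, of z] by (cases "z \<in> \<Omega>") (simp_all add: indicator_def)
  qed
qed

lemma set_integrable_bergman_product:
  assumes f: "f \<in> bergman_space \<Omega>" and g: "g \<in> bergman_space \<Omega>"
  shows "set_integrable lborel \<Omega> (\<lambda>z. f z * cnj (g z))"
proof (rule set_integrable_bergman_bound[OF f g])
  show "continuous_on \<Omega> (\<lambda>z. f z * cnj (g z))"
    by (intro continuous_intros bergman_space_imp_continuous f g)
  show "cmod (f z * cnj (g z)) \<le> 1 * ((cmod (f z))\<^sup>2 + (cmod (g z))\<^sup>2)" for z
    using sum_squares_bound[of "cmod (f z)" "cmod (g z)"]
      mult_nonneg_nonneg[OF norm_ge_zero norm_ge_zero, of "f z" "g z"]
    by (simp only: norm_mult complex_mod_cnj mult_1_left)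
qed

lemma bergman_space_add_scaled:
  assumes f: "f \<in> bergman_space \<Omega>" and g: "g \<in> bergman_space \<Omega>"
  shows "(\<lambda>z. f z + c * g z) \<in> bergman_space \<Omega>"
proof -
  have "set_integrable lborel \<Omega> (\<lambda>z. (cmod (f z + c * g z))\<^sup>2)"
  proof (rule set_integrable_bergman_bound[OF f g])
    show "continuous_on \<Omega> (\<lambda>z. (cmod (f z + c * g z))\<^sup>2)"
      by (intro continuous_intros bergman_space_imp_continuous f g)
    fix z
    let ?C = "2 * (1 + (cmod c)\<^sup>2)"
    have "(cmod (f z + c * g z))\<^sup>2 \<le> (cmod (f z) + cmod (c * g z))\<^sup>2"
      by (intro power_mono norm_triangle_ineq) auto
    also have "\<dots> \<le> 2 * (cmod (f z))\<^sup>2 + 2 * (cmod (c * g z))\<^sup>2"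
      using sum_squares_bound[of "cmod (f z)" "cmod (c * g z)"] by (simp add: power2_sum)
    also have "\<dots> \<le> ?C * ((cmod (f z))\<^sup>2 + (cmod (g z))\<^sup>2)"
      by (simp add: norm_mult power_mult_distrib algebra_simps)
    finally show "norm ((cmod (f z + c * g z))\<^sup>2) \<le> ?C * ((cmod (f z))\<^sup>2 + (cmod (g z))\<^sup>2)"
      by simp
  qed
  then show ?thesis
    using f g by (auto simp: bergman_space_def intro!: holomorphic_intros)
qed

lemma bergman_space_scaled: "f \<in> bergman_space \<Omega> \<Longrightarrow> (\<lambda>z. c * f z) \<in> bergman_space \<Omega>"
  using bergman_space_add_scaled[OF zero_in_bergman_space] by simp

lemma bergman_inner_add_scaled_left:
  assumes "f \<in> bergman_space \<Omega>" "g \<in> bergman_space \<Omega>" "h \<in> bergman_space \<Omega>"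
  shows "bergman_inner \<Omega> (\<lambda>z. f z + c * g z) h = bergman_inner \<Omega> f h + c * bergman_inner \<Omega> g h"
proof -
  have "bergman_inner \<Omega> (\<lambda>z. f z + c * g z) h = (LINT z:\<Omega>|lborel. f z * cnj (h z) + c * (g z * cnj (h z)))"
    by (simp add: bergman_inner_def algebra_simps)
  also have "\<dots> = bergman_inner \<Omega> f h + (LINT z:\<Omega>|lborel. c * (g z * cnj (h z)))"
    unfolding bergman_inner_def using assms
    by (intro set_integral_add(2) set_integrable_mult_right set_integrable_bergman_product)
  finally show ?thesis
    by (simp add: bergman_inner_def)
qed

lemma bergman_inner_scaled_right:
  assumes "f \<in> bergman_space \<Omega>" "g \<in> bergman_space \<Omega>"
  shows "bergman_inner \<Omega> f (\<lambda>z. c * g z) = cnj c * bergman_inner \<Omega> f g"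
proof -
  have "bergman_inner \<Omega> (\<lambda>z. c * g z) f = c * bergman_inner \<Omega> g f"
    using bergman_inner_add_scaled_left[of "\<lambda>z. 0" g f c] assms by (simp add: bergman_inner_def)
  then show ?thesis
    unfolding bergman_inner_commute[of \<Omega> f] by simp
qed

lemma bergman_norm_add_scaled:
  assumes f: "f \<in> bergman_space \<Omega>" and g: "g \<in> bergman_space \<Omega>"
  shows "(bergman_norm \<Omega> (\<lambda>z. f z + c * g z))\<^sup>2
    = (bergman_norm \<Omega> f)\<^sup>2 + 2 * Re (c * bergman_inner \<Omega> g f) + (cmod c)\<^sup>2 * (bergman_norm \<Omega> g)\<^sup>2"
proof -
  let ?h = "\<lambda>z. f z + c * g z"
  have h: "?h \<in> bergman_space \<Omega>"
    using f g by (rule bergman_space_add_scaled)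
  have "bergman_inner \<Omega> ?h ?h = cnj (bergman_inner \<Omega> ?h f) + c * cnj (bergman_inner \<Omega> ?h g)"
    using bergman_inner_add_scaled_left[OF f g h]
    by (simp only: bergman_inner_commute[of \<Omega> f ?h] bergman_inner_commute[of \<Omega> g ?h])
  also have "\<dots> = bergman_inner \<Omega> f f + cnj (c * bergman_inner \<Omega> g f) + c * bergman_inner \<Omega> g f
      + c * cnj c * bergman_inner \<Omega> g g"
    unfolding bergman_inner_add_scaled_left[OF f g f] bergman_inner_add_scaled_left[OF f g g]
    unfolding bergman_inner_self bergman_inner_commute[of \<Omega> f g] by (simp add: algebra_simps)
  finally have "complex_of_real ((bergman_norm \<Omega> ?h)\<^sup>2) = of_real ((bergman_norm \<Omega> f)\<^sup>2)
      + cnj (c * bergman_inner \<Omega> g f) + c * bergman_inner \<Omega> g f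
      + of_real ((cmod c)\<^sup>2 * (bergman_norm \<Omega> g)\<^sup>2)"
    by (simp only: bergman_inner_self complex_norm_square of_real_mult)
  from arg_cong[OF this, of Re] show ?thesis
    by simp
qed

lemma bergman_ball_bounded_on_compact:
  assumes K: "compact K" "K \<subseteq> \<Omega>"
  obtains B where "\<And>f z. f \<in> bergman_space \<Omega> \<Longrightarrow> bergman_norm \<Omega> f \<le> R \<Longrightarrow> z \<in> K \<Longrightarrow> cmod (f z) \<le> B"
proof -
  obtain d where d: "0 < d" "\<And>z. z \<in> K \<Longrightarrow> ball z d \<subseteq> \<Omega>"
    using compact_subset_open_imp_ball_epsilon_subset[OF K(1) open_\<Omega> K(2)] by (metis UN_subset_iff)
  have "cmod (f z) \<le> R / d" if "f \<in> bergman_space \<Omega>" "bergman_norm \<Omega> f \<le> R" "z \<in> K" for f z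
  proof -
    have "cmod (f z) \<le> bergman_norm \<Omega> f / d"
      using norm_le_bergman_norm that d by blast
    also have "\<dots> \<le> R / d"
      using that d by (intro divide_right_mono) auto
    finally show ?thesis .
  qed
  then show thesis
    by (rule that)
qed

lemma bergman_bounded_sequence_convergent_subsequence:
  assumes F: "\<And>n. F n \<in> bergman_space \<Omega>" and bound: "\<And>n. bergman_norm \<Omega> (F n) \<le> R"
  obtains f r where "f holomorphic_on \<Omega>" "strict_mono (r :: nat \<Rightarrow> nat)"
    "\<And>z. z \<in> \<Omega> \<Longrightarrow> (\<lambda>n. F (r n) z) \<longlonglongrightarrow> f z"
proof -
  define H where "H = {f \<in> bergman_space \<Omega>. bergman_norm \<Omega> f \<le> R}"
  have H_holomorphic: "f holomorphic_on \<Omega>" if "f \<in> H" for f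
    using that bergman_space_imp_holomorphic by (simp add: H_def)
  have H_bounded: "\<exists>B. \<forall>f\<in>H. \<forall>z\<in>K. cmod (f z) \<le> B" if K: "compact K" "K \<subseteq> \<Omega>" for K
    using bergman_ball_bounded_on_compact[OF K, of R] unfolding H_def by (metis mem_Collect_eq)
  have F_in_H: "range F \<subseteq> H"
    using F bound by (auto simp: H_def)
  show thesis
    by (rule Montel[OF open_\<Omega> H_holomorphic H_bounded F_in_H], assumption+, rule that)
qed

lemma bergman_norm_limit_le:
  assumes F: "\<And>n. F n \<in> bergman_space \<Omega>" and bound: "\<And>n. bergman_norm \<Omega> (F n) \<le> R n" and R: "R \<longlonglongrightarrow> m"
    and f: "f holomorphic_on \<Omega>" and lim: "\<And>z. z \<in> \<Omega> \<Longrightarrow> (\<lambda>n. F n z) \<longlonglongrightarrow> f z"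
  shows "f \<in> bergman_space \<Omega>" "bergman_norm \<Omega> f \<le> m"
proof -
  let ?u = "\<lambda>n z. ennreal (indicator \<Omega> z *\<^sub>R (cmod (F n z))\<^sup>2)"
  have "continuous_on \<Omega> (\<lambda>z. (cmod (F n z))\<^sup>2)" for n
    by (intro continuous_intros bergman_space_imp_continuous F)
  from measurable_compose[OF borel_measurable_indicator_scaleR[OF this] measurable_ennreal]
  have u_measurable: "?u n \<in> borel_measurable lborel" for n
    by simp
  have "(\<integral>\<^sup>+z\<in>\<Omega>. ennreal ((cmod (f z))\<^sup>2) \<partial>lborel) = (\<integral>\<^sup>+z. liminf (\<lambda>n. ?u n z) \<partial>lborel)"
  proof (rule nn_integral_cong)
    fix z
    show "ennreal ((cmod (f z))\<^sup>2) * indicator \<Omega> z = liminf (\<lambda>n. ?u n z)"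
    proof (cases "z \<in> \<Omega>")
      case True
      have "(\<lambda>n. ennreal ((cmod (F n z))\<^sup>2)) \<longlonglongrightarrow> ennreal ((cmod (f z))\<^sup>2)"
        by (intro tendsto_ennrealI tendsto_intros lim True)
      from lim_imp_Liminf[OF _ this] show ?thesis
        using True by simp
    qed (simp add: Liminf_const)
  qed
  also have "\<dots> \<le> liminf (\<lambda>n. \<integral>\<^sup>+z. ?u n z \<partial>lborel)"
    by (rule nn_integral_liminf[OF u_measurable])
  also have "\<dots> = liminf (\<lambda>n. ennreal ((bergman_norm \<Omega> (F n))\<^sup>2))"
  proof -
    have "(\<integral>\<^sup>+z. ?u n z \<partial>lborel) = ennreal ((bergman_norm \<Omega> (F n))\<^sup>2)" for n
      unfolding nn_integral_bergman_space[OF F, symmetric]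
      by (intro nn_integral_cong) (auto simp: indicator_def)
    then show ?thesis
      by simp
  qed
  also have "\<dots> \<le> liminf (\<lambda>n. ennreal ((R n)\<^sup>2))"
    using bound by (intro Liminf_mono always_eventually allI ennreal_leI power_mono) auto
  also have "\<dots> = ennreal (m\<^sup>2)"
    by (intro lim_imp_Liminf tendsto_ennrealI tendsto_intros R) simp
  finally have le: "(\<integral>\<^sup>+z\<in>\<Omega>. ennreal ((cmod (f z))\<^sup>2) \<partial>lborel) \<le> ennreal (m\<^sup>2)" .
  have "0 \<le> m"
    using LIMSEQ_le_const[OF R] order_trans[OF bergman_norm_nonneg bound] by blast
  from bergman_spaceI[OF f this le]
  show "f \<in> bergman_space \<Omega>" "bergman_norm \<Omega> f \<le> m" .
qed

text \<open>Montel's theorem and Fatou's lemma replace the completeness of the Bergman space here.\<close>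

lemma bergman_minimiser_exists:
  assumes "w \<in> \<Omega>" and g: "g \<in> bergman_space \<Omega>" "g w = 1"
  obtains f where "f \<in> bergman_space \<Omega>" "f w = 1"
    "\<And>h. h \<in> bergman_space \<Omega> \<Longrightarrow> h w = 1 \<Longrightarrow> bergman_norm \<Omega> f \<le> bergman_norm \<Omega> h"
proof -
  define S where "S = {h \<in> bergman_space \<Omega>. h w = 1}"
  define m where "m = (INF h\<in>S. bergman_norm \<Omega> h)"
  have "S \<noteq> {}"
    using g by (auto simp: S_def)
  have bdd: "bdd_below (bergman_norm \<Omega> ` S)"
    by (rule bdd_belowI2[where m = 0]) simp
  obtain F where F: "\<And>n. F n \<in> S" "\<And>n. bergman_norm \<Omega> (F n) < m + 1 / real (Suc n)"
    using minimising_sequence_exists[OF \<open>S \<noteq> {}\<close> bdd] unfolding m_def by blast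
  have F_space: "F n \<in> bergman_space \<Omega>" and F_w: "F n w = 1" for n
    using F(1)[of n] by (auto simp: S_def)
  have F_norm: "bergman_norm \<Omega> (F n) \<le> m + 1" for n
    using F(2)[of n] by (rule order_trans[OF less_imp_le]) simp
  obtain f and r :: "nat \<Rightarrow> nat" where f: "f holomorphic_on \<Omega>" and r: "strict_mono r"
    and lim: "\<And>z. z \<in> \<Omega> \<Longrightarrow> (\<lambda>n. F (r n) z) \<longlonglongrightarrow> f z"
    using bergman_bounded_sequence_convergent_subsequence[where F = F, OF F_space F_norm] by blast
  have "(\<lambda>n. F (r n) w) \<longlonglongrightarrow> 1"
    by (simp add: F_w)
  then have "f w = 1"
    using LIMSEQ_unique[OF lim[OF \<open>w \<in> \<Omega>\<close>]] by simp
  have "(\<lambda>n. m + 1 / real (Suc n)) \<longlonglongrightarrow> m"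
    by real_asymp
  from LIMSEQ_subseq_LIMSEQ[OF this r]
  have "(\<lambda>n. m + 1 / real (Suc (r n))) \<longlonglongrightarrow> m"
    by (simp add: o_def)
  from bergman_norm_limit_le[where F = "\<lambda>n. F (r n)", OF F_space less_imp_le[OF F(2)] this f lim]
  have f_space: "f \<in> bergman_space \<Omega>" and f_norm: "bergman_norm \<Omega> f \<le> m"
    by auto
  show thesis
  proof (rule that)
    fix h assume "h \<in> bergman_space \<Omega>" "h w = 1"
    then have "m \<le> bergman_norm \<Omega> h"
      unfolding m_def by (intro cINF_lower[OF bdd]) (simp add: S_def)
    with f_norm show "bergman_norm \<Omega> f \<le> bergman_norm \<Omega> h"
      by simp
  qed fact+
qed

lemma bergman_minimiser_orthogonal:
  assumes f: "f \<in> bergman_space \<Omega>"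
    and minimal: "\<And>h. h \<in> bergman_space \<Omega> \<Longrightarrow> h w = f w \<Longrightarrow> bergman_norm \<Omega> f \<le> bergman_norm \<Omega> h"
    and g: "g \<in> bergman_space \<Omega>" "g w = 0"
  shows "bergman_inner \<Omega> g f = 0"
proof (rule ccontr)
  define p where "p = bergman_inner \<Omega> g f"
  define q where "q = (bergman_norm \<Omega> g)\<^sup>2"
  define l where "l = 1 / (q + 1)"
  define c where "c = - (of_real l * cnj p)"
  assume "bergman_inner \<Omega> g f \<noteq> 0"
  then have "0 < (cmod p)\<^sup>2"
    by (simp add: p_def)
  have "0 < q + 1"
    by (simp add: q_def add_nonneg_pos)
  then have l: "0 < l" "l * q < 1"
    by (simp_all add: l_def)
  have "bergman_norm \<Omega> f \<le> bergman_norm \<Omega> (\<lambda>z. f z + c * g z)"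
    using f g by (intro minimal bergman_space_add_scaled) auto
  then have "(bergman_norm \<Omega> f)\<^sup>2 \<le> (bergman_norm \<Omega> (\<lambda>z. f z + c * g z))\<^sup>2"
    by (rule power_mono) simp
  also have "\<dots> = (bergman_norm \<Omega> f)\<^sup>2 + 2 * Re (c * p) + (cmod c)\<^sup>2 * q"
    unfolding p_def q_def by (rule bergman_norm_add_scaled[OF f g(1)])
  also have "c * p = of_real (- l * (cmod p)\<^sup>2)"
    by (simp add: c_def complex_norm_square[symmetric] mult_ac del: of_real_power)
  also have "(cmod c)\<^sup>2 = l\<^sup>2 * (cmod p)\<^sup>2"
    by (simp add: c_def norm_mult power_mult_distrib)
  finally have "0 \<le> l * (cmod p)\<^sup>2 * (l * q - 2)"
    by (simp add: algebra_simps power2_eq_square)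
  moreover have "0 < l * (cmod p)\<^sup>2"
    using l(1) \<open>0 < (cmod p)\<^sup>2\<close> by (rule mult_pos_pos)
  ultimately show False
    using l by (simp add: zero_le_mult_iff)
qed

lemma bergman_minimiser_reproducing:
  assumes "w \<in> \<Omega>" and f: "f \<in> bergman_space \<Omega>" "f w = 1"
    and minimal: "\<And>h. h \<in> bergman_space \<Omega> \<Longrightarrow> h w = 1 \<Longrightarrow> bergman_norm \<Omega> f \<le> bergman_norm \<Omega> h"
  shows "bergman_reproducing \<Omega> w (\<lambda>z. of_real (1 / (bergman_norm \<Omega> f)\<^sup>2) * f z)"
proof -
  define N where "N = (bergman_norm \<Omega> f)\<^sup>2"
  have "N \<noteq> 0"
    using bergman_norm_eq_0_imp_zero[OF f(1) _ \<open>w \<in> \<Omega>\<close>] f(2) by (auto simp: N_def)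
  have "h w = bergman_inner \<Omega> h (\<lambda>z. of_real (1 / N) * f z)" if h: "h \<in> bergman_space \<Omega>" for h
  proof -
    have "bergman_inner \<Omega> (\<lambda>z. h z + (- h w) * f z) f = 0"
      using f h minimal by (intro bergman_minimiser_orthogonal[where w = w] bergman_space_add_scaled) auto
    then have "bergman_inner \<Omega> h f = h w * of_real N"
      unfolding bergman_inner_add_scaled_left[OF h f(1) f(1)] bergman_inner_self N_def by simp
    then show ?thesis
      unfolding bergman_inner_scaled_right[OF h f(1)] using \<open>N \<noteq> 0\<close> by simp
  qed
  with bergman_space_scaled[OF f(1)] show ?thesis
    unfolding bergman_reproducing_def N_def by blast
qed

lemma bergman_reproducing_exists:
  assumes "w \<in> \<Omega>"
  obtains k where "bergman_reproducing \<Omega> w k"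
proof (cases "\<exists>g\<in>bergman_space \<Omega>. g w \<noteq> 0")
  case False
  then have "bergman_reproducing \<Omega> w (\<lambda>z. 0)"
    by (simp add: bergman_reproducing_def bergman_inner_def)
  then show thesis
    by (rule that)
next
  case True
  then obtain g where g: "g \<in> bergman_space \<Omega>" "g w \<noteq> 0"
    by blast
  define h where "h z = 1 / g w * g z" for z
  have h: "h \<in> bergman_space \<Omega>" "h w = 1"
    using bergman_space_scaled[OF g(1), of "1 / g w"] g(2) by (simp_all add: h_def[abs_def])
  obtain f where "f \<in> bergman_space \<Omega>" "f w = 1"
    "\<And>h. h \<in> bergman_space \<Omega> \<Longrightarrow> h w = 1 \<Longrightarrow> bergman_norm \<Omega> f \<le> bergman_norm \<Omega> h"
    using bergman_minimiser_exists[OF assms h] by blast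
  from bergman_minimiser_reproducing[OF assms this] show thesis
    by (rule that)
qed

lemma bergman_reproducing_unique:
  assumes h: "bergman_reproducing \<Omega> w h" and k: "bergman_reproducing \<Omega> w k" and "z \<in> \<Omega>"
  shows "h z = k z"
proof -
  define d where "d = (\<lambda>z. h z + (-1) * k z)"
  have d: "d \<in> bergman_space \<Omega>"
    unfolding d_def using h k by (intro bergman_space_add_scaled) (auto simp: bergman_reproducing_def)
  have "bergman_inner \<Omega> d d = bergman_inner \<Omega> h d + (-1) * bergman_inner \<Omega> k d"
    using bergman_inner_add_scaled_left[OF _ _ d, of h k "-1", folded d_def] h k
    by (simp add: bergman_reproducing_def)
  also have "\<dots> = cnj (d w) - cnj (d w)"
    using h k d bergman_inner_commute[of \<Omega> h d] bergman_inner_commute[of \<Omega> k d]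
    by (simp add: bergman_reproducing_def)
  finally have "bergman_norm \<Omega> d = 0"
    by (simp add: bergman_inner_self)
  then show ?thesis
    using bergman_norm_eq_0_imp_zero[OF d _ \<open>z \<in> \<Omega>\<close>] by (simp add: d_def)
qed

lemma bergman_kernel2_eq:
  assumes k: "bergman_reproducing \<Omega> w k" and "\<zeta> \<in> \<Omega>"
  shows "bergman_kernel2 \<Omega> \<zeta> w = k \<zeta>"
proof -
  define k' where "k' z = (if z \<in> \<Omega> then k z else 0)" for z
  have "k' \<in> bergman_space \<Omega>"
    using k bergman_space_cong[of \<Omega> k' k] by (simp add: k'_def bergman_reproducing_def)
  moreover have "bergman_inner \<Omega> f k' = bergman_inner \<Omega> f k" for f
    by (rule bergman_inner_cong) (simp_all add: k'_def)
  ultimately have k': "bergman_reproducing \<Omega> w k'"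
    using k by (simp add: bergman_reproducing_def)
  have "(THE h. bergman_reproducing \<Omega> w h \<and> (\<forall>z. z \<notin> \<Omega> \<longrightarrow> h z = 0)) = k'"
  proof (rule the_equality)
    fix h assume h: "bergman_reproducing \<Omega> w h \<and> (\<forall>z. z \<notin> \<Omega> \<longrightarrow> h z = 0)"
    show "h = k'"
    proof
      fix z
      show "h z = k' z"
        using h bergman_reproducing_unique[OF _ k', of h z] by (cases "z \<in> \<Omega>") (simp_all add: k'_def)
    qed
  qed (simp add: k' k'_def)
  then show ?thesis
    using \<open>\<zeta> \<in> \<Omega>\<close>
    by (simp add: bergman_kernel2_def bergman_reproducing_def bergman_inner_def k'_def conj_ac)
qed

lemma bergman_kernel_le:
  assumes "w \<in> \<Omega>" and bound: "\<And>f. f \<in> bergman_space \<Omega> \<Longrightarrow> cmod (f w) \<le> B * bergman_norm \<Omega> f"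
  shows "bergman_kernel \<Omega> w \<le> B\<^sup>2"
proof -
  obtain k where k: "bergman_reproducing \<Omega> w k"
    using bergman_reproducing_exists[OF \<open>w \<in> \<Omega>\<close>] .
  then have k_w: "k w = of_real ((bergman_norm \<Omega> k)\<^sup>2)"
    by (metis bergman_reproducing_def bergman_inner_self)
  have "(bergman_norm \<Omega> k)\<^sup>2 \<le> B * bergman_norm \<Omega> k"
    using bound[of k] k by (simp add: k_w bergman_reproducing_def norm_power)
  then have "bergman_norm \<Omega> k * bergman_norm \<Omega> k \<le> B * bergman_norm \<Omega> k"
    by (simp only: power2_eq_square)
  then have "(bergman_norm \<Omega> k)\<^sup>2 \<le> B\<^sup>2"
    using bergman_norm_nonneg[of \<Omega> k]
    by (cases "bergman_norm \<Omega> k = 0") (auto simp: mult_le_cancel_right less_le intro: power_mono)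
  then show ?thesis
    by (simp add: bergman_kernel_def bergman_kernel2_eq[OF k \<open>w \<in> \<Omega>\<close>] k_w)
qed

end

section \<open>The kernel on an annulus\<close>

lemma norm_circle_mean_le_bergman_norm:
  assumes "open \<Omega>" and f: "f \<in> bergman_space \<Omega>" and A: "closed_annulus a s r \<subseteq> \<Omega>"
    and s: "0 < s" "s < r" and u: "u \<in> closed_annulus a s r"
  shows "cmod (circle_mean (\<lambda>w. (w - a) * f w) a u) \<le> bergman_norm \<Omega> f / sqrt (2 * pi * ln (r / s))"
proof -
  let ?c = "circle_mean (\<lambda>w. (w - a) * f w) a u"
  have "ennreal (2 * pi * ln (r / s) * (cmod ?c)\<^sup>2)
      \<le> (\<integral>\<^sup>+z\<in>closed_annulus a s r. ennreal ((cmod (f z))\<^sup>2) \<partial>lborel)"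
    using \<open>open \<Omega>\<close> bergman_space_imp_holomorphic[OF f] A s(1) u
    by (rule power2_circle_mean_le_nn_integral_annulus)
  also have "\<dots> \<le> (\<integral>\<^sup>+z\<in>\<Omega>. ennreal ((cmod (f z))\<^sup>2) \<partial>lborel)"
    using A by (intro nn_integral_mono) (auto simp: indicator_def simp del: mem_closed_annulus)
  finally have "2 * pi * ln (r / s) * (cmod ?c)\<^sup>2 \<le> (bergman_norm \<Omega> f)\<^sup>2"
    by (simp add: nn_integral_bergman_space[OF f])
  then have "(sqrt (2 * pi * ln (r / s)) * cmod ?c)\<^sup>2 \<le> (bergman_norm \<Omega> f)\<^sup>2"
    using s by (simp add: power_mult_distrib)
  then have "sqrt (2 * pi * ln (r / s)) * cmod ?c \<le> bergman_norm \<Omega> f"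
    by (rule power2_le_imp_le) simp
  then show ?thesis
    using s by (simp add: field_simps)
qed

lemma norm_le_bergman_norm_on_annulus:
  assumes f: "f \<in> bergman_space \<Omega>" and A: "closed_annulus a s r \<subseteq> \<Omega>"
    and "0 < d" and w: "s + d \<le> dist a w" "dist a w + d \<le> r"
  shows "cmod (f w) \<le> bergman_norm \<Omega> f / d"
proof (rule norm_le_bergman_norm[OF f \<open>0 < d\<close>])
  have "ball w d \<subseteq> closed_annulus a s r"
  proof
    fix y assume "y \<in> ball w d"
    then show "y \<in> closed_annulus a s r"
      using w dist_triangle[of a w y] dist_triangle[of a y w] by (simp add: dist_commute)
  qed
  then show "ball w d \<subseteq> \<Omega>"
    using A by blast
qed

lemma norm_diff_circle_mean_le_bergman_norm:
  assumes "open \<Omega>" and f: "f \<in> bergman_space \<Omega>" and A: "closed_annulus a s r \<subseteq> \<Omega>"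
    and s: "0 < s" "4 * s \<le> dist a z" and z: "dist a z \<le> r / 4" and u: "dist a u = r / 2"
  shows "cmod ((z - a) * f z - circle_mean (\<lambda>w. (w - a) * f w) a u)
    \<le> 8 * (dist a z / r + s / dist a z) * bergman_norm \<Omega> f"
proof -
  define \<rho> N where "\<rho> = dist a z" and "N = bergman_norm \<Omega> f"
  have \<rho>: "0 < \<rho>" "0 < r" "4 * s \<le> \<rho>" "\<rho> \<le> r / 4"
    using s z by (auto simp: \<rho>_def)
  have "0 \<le> N"
    by (simp add: N_def)
  define v where "v = a + of_real (2 * s)"
  have v: "dist a v = 2 * s"
    using s by (simp add: v_def dist_norm)
  have h_bound: "cmod ((w - a) * f w) \<le> dist a w * (N / d)"
    if "0 < d" "s + d \<le> dist a w" "dist a w + d \<le> r" for w d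
    unfolding norm_mult dist_norm norm_minus_commute[of a w] N_def
    by (intro mult_left_mono norm_le_bergman_norm_on_annulus[OF f A that]) simp
  have "cmod ((z - a) * f z - circle_mean (\<lambda>w. (w - a) * f w) a u)
      \<le> dist a z * (2 * N / (dist a u - dist a z)) + 2 * N * dist a v / (dist a z - dist a v)"
  proof (rule norm_diff_circle_mean_le[OF \<open>open \<Omega>\<close>])
    show "(\<lambda>w. (w - a) * f w) holomorphic_on \<Omega>"
      by (intro holomorphic_intros bergman_space_imp_holomorphic f)
    show "closed_annulus a (dist a v) (dist a u) \<subseteq> \<Omega>"
      using s \<rho> u v by (intro order_trans[OF _ A]) auto
    show "v \<noteq> a" "dist a v < dist a z" "dist a z < dist a u"
      using s \<rho> u v by (auto simp: \<rho>_def)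
    show "cmod ((w - a) * f w) \<le> 2 * N" if "dist a w = dist a u" for w
      using h_bound[of "r / 4" w] that u \<rho> s by simp
    show "cmod ((w - a) * f w) \<le> 2 * N" if "dist a w = dist a v" for w
      using h_bound[of s w] that v \<rho> s by simp
  qed
  also have "\<dots> = \<rho> * (2 * N / (r / 2 - \<rho>)) + 2 * N * (2 * s) / (\<rho> - 2 * s)"
    by (simp add: u v \<rho>_def)
  also have "\<dots> \<le> \<rho> * (2 * N / (r / 4)) + 2 * N * (2 * s) / (\<rho> / 2)"
    using \<rho> s \<open>0 \<le> N\<close> by (intro add_mono mult_left_mono divide_left_mono mult_pos_pos) auto
  also have "\<dots> = 8 * (\<rho> / r + s / \<rho>) * N"
    using \<rho> by (simp add: field_simps)
  finally show ?thesis
    by (simp add: \<rho>_def N_def)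
qed

lemma bergman_kernel_annulus_bound:
  assumes "open \<Omega>" and A: "closed_annulus a s r \<subseteq> \<Omega>"
    and s: "0 < s" "4 * s \<le> dist a z" and z: "dist a z \<le> r / 4"
  shows "bergman_kernel \<Omega> z * (dist a z)\<^sup>2
    \<le> (1 / sqrt (2 * pi * ln (r / s)) + 8 * (dist a z / r + s / dist a z))\<^sup>2"
proof -
  define \<rho> where "\<rho> = dist a z"
  define E where "E = 1 / sqrt (2 * pi * ln (r / s)) + 8 * (\<rho> / r + s / \<rho>)"
  have \<rho>: "0 < \<rho>" "s < r"
    using s z by (auto simp: \<rho>_def)
  define u where "u = a + of_real (r / 2)"
  have u: "dist a u = r / 2"
    using s \<rho> by (simp add: u_def dist_norm)
  have "bergman_kernel \<Omega> z \<le> (E / \<rho>)\<^sup>2"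
  proof (rule bergman_kernel_le[OF \<open>open \<Omega>\<close>])
    show "z \<in> \<Omega>"
      using A s z \<rho> by (intro subsetD[OF A]) auto
    fix f assume f: "f \<in> bergman_space \<Omega>"
    let ?c = "circle_mean (\<lambda>w. (w - a) * f w) a u"
    have "cmod ((z - a) * f z) \<le> cmod ?c + cmod ((z - a) * f z - ?c)"
      using norm_triangle_ineq[of ?c "(z - a) * f z - ?c"] by simp
    also have "\<dots> \<le> bergman_norm \<Omega> f / sqrt (2 * pi * ln (r / s)) + 8 * (\<rho> / r + s / \<rho>) * bergman_norm \<Omega> f"
      unfolding \<rho>_def using \<rho>(2) s z u
      by (intro add_mono norm_circle_mean_le_bergman_norm[OF \<open>open \<Omega>\<close> f A s(1)]
          norm_diff_circle_mean_le_bergman_norm[OF \<open>open \<Omega>\<close> f A s z u]) auto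
    also have "\<dots> = E * bergman_norm \<Omega> f"
      by (simp add: E_def algebra_simps)
    finally have "\<rho> * cmod (f z) \<le> E * bergman_norm \<Omega> f"
      by (simp add: norm_mult \<rho>_def dist_norm norm_minus_commute)
    then show "cmod (f z) \<le> E / \<rho> * bergman_norm \<Omega> f"
      using \<rho> by (simp add: field_simps)
  qed
  then have "bergman_kernel \<Omega> z * \<rho>\<^sup>2 \<le> E\<^sup>2"
    using \<rho> by (simp add: field_simps)
  then show ?thesis
    by (simp add: E_def \<rho>_def)
qed

text \<open>On the circle of radius \<open>r / L\<close> both error terms are \<open>o(L\<^sup>-\<^sup>1\<^sup>/\<^sup>2)\<close>, while \<open>log (L / r)\<close> stays
  asymptotic to \<open>log (1 / r)\<close> when \<open>L = O(log (1 / r))\<close>.\<close>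

lemma bergman_kernel_annulus_modulus:
  assumes "1 / (2 * pi) < \<eta>"
  shows "\<forall>\<^sub>F L in at_top. \<forall>\<Omega> a z r. open \<Omega> \<longrightarrow> 0 < r \<longrightarrow> closed_annulus a (r * exp (- L)) r \<subseteq> \<Omega> \<longrightarrow>
    dist a z = r / L \<longrightarrow> bergman_kernel \<Omega> z * (r / L)\<^sup>2 \<le> \<eta> / L"
proof -
  have "((\<lambda>L. (1 / sqrt (2 * pi * L) + 8 * (1 / L + L * exp (- L)))\<^sup>2 * L) \<longlongrightarrow> 1 / (2 * pi)) at_top"
    by (real_asymp simp: powr_half_sqrt inverse_eq_divide power_divide)
  then have "\<forall>\<^sub>F L in at_top. (1 / sqrt (2 * pi * L) + 8 * (1 / L + L * exp (- L)))\<^sup>2 * L < \<eta>"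
    using assms by (rule order_tendstoD)
  moreover have "\<forall>\<^sub>F L::real in at_top. 4 * L * exp (- L) \<le> 1" "\<forall>\<^sub>F L::real in at_top. 4 \<le> L"
    by real_asymp+
  ultimately show ?thesis
  proof eventually_elim
    case (elim L)
    show ?case
    proof (intro allI impI)
      fix \<Omega> and a z :: complex and r :: real
      assume "open \<Omega>" "0 < r" and A: "closed_annulus a (r * exp (- L)) r \<subseteq> \<Omega>" and z: "dist a z = r / L"
      have "bergman_kernel \<Omega> z * (dist a z)\<^sup>2 \<le> (1 / sqrt (2 * pi * ln (r / (r * exp (- L))))
          + 8 * (dist a z / r + r * exp (- L) / dist a z))\<^sup>2"
        by (rule bergman_kernel_annulus_bound[OF \<open>open \<Omega>\<close> A])
          (use elim \<open>0 < r\<close> in \<open>auto simp: z field_simps\<close>)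
      also have "\<dots> = (1 / sqrt (2 * pi * L) + 8 * (1 / L + L * exp (- L)))\<^sup>2"
        using \<open>0 < r\<close> by (simp add: z ln_div mult.commute)
      also have "\<dots> \<le> \<eta> / L"
        using elim by (simp add: field_simps)
      finally show "bergman_kernel \<Omega> z * (r / L)\<^sup>2 \<le> \<eta> / L"
        by (simp add: z)
    qed
  qed
qed

section \<open>Comparison functions and perfectness conditions\<close>

lemma mono_on_square_times:
  fixes \<phi> :: "real \<Rightarrow> real"
  assumes deriv: "\<And>t. t \<in> {0<..t0} \<Longrightarrow> (\<phi> has_real_derivative \<phi>' t) (at t)"
    and "\<And>t. t \<in> {0<..t0} \<Longrightarrow> 1 / 2 \<le> \<phi> t" and "\<And>t. t \<in> {0<..t0} \<Longrightarrow> - 1 / t \<le> \<phi>' t"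
  shows "mono_on {0<..t0} (\<lambda>t. t\<^sup>2 * \<phi> t)"
proof (rule mono_onI)
  fix x y assume xy: "x \<in> {0<..t0}" "y \<in> {0<..t0}" "x \<le> y"
  show "x\<^sup>2 * \<phi> x \<le> y\<^sup>2 * \<phi> y"
  proof (rule DERIV_nonneg_imp_nondecreasing[OF \<open>x \<le> y\<close>])
    fix t assume "x \<le> t" "t \<le> y"
    then have t: "t \<in> {0<..t0}" "0 < t"
      using xy by auto
    have "0 = 2 * t * (1 / 2) + t\<^sup>2 * (- 1 / t)"
      using t by (simp add: power2_eq_square)
    also have "\<dots> \<le> 2 * t * \<phi> t + t\<^sup>2 * \<phi>' t"
      using t assms(2,3)[OF t(1)] by (intro add_mono mult_left_mono) auto
    finally show "\<exists>d. ((\<lambda>t. t\<^sup>2 * \<phi> t) has_real_derivative d) (at t) \<and> 0 \<le> d"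
      using deriv[OF t(1)]
      by (intro exI[of _ "2 * t * \<phi> t + t\<^sup>2 * \<phi>' t"]) (auto intro!: derivative_eq_intros)
  qed
qed

lemma ln_inverse_ge:
  fixes t :: real
  assumes "0 < t" "t \<le> exp (- x)"
  shows "x \<le> ln (1 / t)"
proof -
  have "ln t \<le> ln (exp (- x))"
    using assms by (subst ln_le_cancel_iff) auto
  with \<open>0 < t\<close> show ?thesis
    by (simp add: ln_div)
qed

lemma mono_on_square_times_ln: "mono_on {0<..exp (- (1 / 2))} (\<lambda>t::real. t\<^sup>2 * ln (1 / t))"
proof (rule mono_on_square_times)
  show "((\<lambda>t. ln (1 / t)) has_real_derivative - 1 / t) (at t)" if "t \<in> {0<..exp (- (1 / 2))}" for t :: real
    using that by (auto intro!: derivative_eq_intros simp: power2_eq_square field_simps)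
  show "1 / 2 \<le> ln (1 / t)" if "t \<in> {0<..exp (- (1 / 2))}" for t :: real
    using ln_inverse_ge[of t "1 / 2"] that by simp
qed simp

lemma ln_ln_inverse_ge:
  fixes t :: real
  assumes "0 < t" "t \<le> exp (- exp x)"
  shows "x \<le> ln (ln (1 / t))"
  using ln_inverse_ge[OF assms] by (subst ln_ge_iff) (auto intro: less_le_trans[OF exp_gt_zero])

lemma mono_on_square_times_ln_ln: "mono_on {0<..exp (- exp (1 / 2))} (\<lambda>t::real. t\<^sup>2 * ln (ln (1 / t)))"
proof (rule mono_on_square_times)
  fix t :: real assume t: "t \<in> {0<..exp (- exp (1 / 2))}"
  have "1 \<le> exp (1 / 2 :: real)"
    by simp
  also have "\<dots> \<le> ln (1 / t)"
    using t by (intro ln_inverse_ge) auto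
  finally have ln_ge: "1 \<le> ln (1 / t)" .
  then have "0 < ln (1 / t)"
    by linarith
  show "((\<lambda>t. ln (ln (1 / t))) has_real_derivative - 1 / t / ln (1 / t)) (at t)"
    using t \<open>0 < ln (1 / t)\<close> by (auto intro!: derivative_eq_intros simp: power2_eq_square field_simps)
  have "1 / t / ln (1 / t) \<le> 1 / t / 1"
    using t ln_ge \<open>0 < ln (1 / t)\<close> by (intro divide_left_mono) auto
  then show "- 1 / t \<le> - 1 / t / ln (1 / t)"
    by simp
  show "1 / 2 \<le> ln (ln (1 / t))"
    using ln_ln_inverse_ge[of t "1 / 2"] t by simp
qed

lemma h_uniformly_perfect_near_0:
  assumes "closed K" and meets: "\<forall>\<^sub>F r in at_right 0. \<forall>a\<in>K. K \<inter> closed_annulus a (h r) r \<noteq> {}"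
    and "0 < r1" "mono_on {0..<r1} h" "\<And>r. r \<in> {0..<r1} \<Longrightarrow> h r \<le> r"
  obtains r0 where "0 < r0" "h_uniformly_perfect h r0 K"
proof -
  obtain r2 where "0 < r2" and r2: "\<And>r. 0 < r \<Longrightarrow> r < r2 \<Longrightarrow> \<forall>a\<in>K. K \<inter> closed_annulus a (h r) r \<noteq> {}"
    using meets unfolding eventually_at_right_field by auto
  define r0 where "r0 = min r1 r2"
  have "\<exists>z\<in>K. h r \<le> cmod (z - a) \<and> cmod (z - a) \<le> r" if "a \<in> K" "0 < r \<and> r < r0" for a r
    using r2[of r] that by (force simp: r0_def dist_norm norm_minus_commute)
  moreover have "mono_on {0..<r0} h"
    using assms(4) by (rule mono_on_subset) (auto simp: r0_def)
  ultimately have "h_uniformly_perfect h r0 K"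
    unfolding h_uniformly_perfect_def using assms \<open>0 < r2\<close> by (auto simp: r0_def)
  then show thesis
    using that[of r0] assms(3) \<open>0 < r2\<close> by (simp add: r0_def)
qed

lemma condU1I:
  assumes "1 \<le> \<alpha>" "closed K" and meets: "\<forall>\<^sub>F r in at_right 0. \<forall>a\<in>K. K \<inter> closed_annulus a (h1 \<alpha> r) r \<noteq> {}"
  shows "condU1 \<alpha> K"
proof -
  have "mono_on {0..<1} (h1 \<alpha>)"
    using \<open>1 \<le> \<alpha>\<close> by (auto intro!: mono_onI powr_mono2 simp: h1_def)
  moreover have "h1 \<alpha> r \<le> r" if "r \<in> {0..<1}" for r
    using powr_mono'[of 1 \<alpha> r] that \<open>1 \<le> \<alpha>\<close> by (simp add: h1_def)
  ultimately obtain r0 where "0 < r0" "h_uniformly_perfect (h1 \<alpha>) r0 K"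
    using h_uniformly_perfect_near_0[OF assms(2) meets zero_less_one] by blast
  then show ?thesis
    unfolding condU1_def by (intro exI[of _ 1] exI[of _ r0]) simp
qed

lemma condU2I:
  assumes "0 \<le> \<beta>" "closed K" and meets: "\<forall>\<^sub>F r in at_right 0. \<forall>a\<in>K. K \<inter> closed_annulus a (h2 \<beta> r) r \<noteq> {}"
  shows "condU2 \<beta> K"
proof -
  have ln_ge: "1 \<le> - ln r" if "0 < r" "r < exp (- 1)" for r :: real
    using ln_inverse_ge[of r 1] that by (simp add: ln_div)
  have "mono_on {0..<exp (- 1)} (h2 \<beta>)"
  proof (rule mono_onI)
    fix x y :: real assume xy: "x \<in> {0..<exp (- 1)}" "y \<in> {0..<exp (- 1)}" "x \<le> y"
    show "h2 \<beta> x \<le> h2 \<beta> y"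
    proof (cases "x = 0")
      case False
      have "0 < - ln y"
        using ln_ge[of y] xy False by (intro less_le_trans[OF zero_less_one]) auto
      then have "(- ln x) powr (- \<beta>) \<le> (- ln y) powr (- \<beta>)"
        using xy False \<open>0 \<le> \<beta>\<close> by (intro powr_mono2') auto
      then show ?thesis
        unfolding h2_def using xy by (intro mult_mono) auto
    qed (use xy in \<open>simp add: h2_def\<close>)
  qed
  moreover have "h2 \<beta> r \<le> r" if "r \<in> {0..<exp (- 1)}" for r
  proof (cases "r = 0")
    case False
    then have "(- ln r) powr (- \<beta>) \<le> 1 powr (- \<beta>)"
      using that ln_ge[of r] \<open>0 \<le> \<beta>\<close> by (intro powr_mono2') auto
    then show ?thesis
      unfolding h2_def using that by (intro mult_left_le) auto
  qed (simp add: h2_def)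
  ultimately obtain r0 where "0 < r0" "h_uniformly_perfect (h2 \<beta>) r0 K"
    using h_uniformly_perfect_near_0[OF assms(2) meets exp_gt_zero] by blast
  then show ?thesis
    unfolding condU2_def by (intro exI[of _ 1] exI[of _ r0]) simp
qed

section \<open>Annuli missing the boundary\<close>

definition bergman_lower_bound :: "complex set \<Rightarrow> real \<Rightarrow> real \<Rightarrow> (real \<Rightarrow> real) \<Rightarrow> bool" where
  "bergman_lower_bound \<Omega> \<epsilon> c \<phi> \<longleftrightarrow> (\<forall>z\<in>\<Omega>. boundary_dist \<Omega> z < \<epsilon> \<longrightarrow>
     bergman_kernel \<Omega> z \<ge> c / ((boundary_dist \<Omega> z)\<^sup>2 * \<phi> (boundary_dist \<Omega> z)))"

locale proper_domain =
  fixes \<Omega> :: "complex set"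
  assumes open_domain: "open \<Omega>" and connected_domain: "connected \<Omega>"
    and domain_nonempty: "\<Omega> \<noteq> {}" and domain_proper: "\<Omega> \<noteq> UNIV"
begin

lemma frontier_nonempty: "frontier \<Omega> \<noteq> {}"
  using domain_nonempty domain_proper by (simp add: frontier_eq_empty)

lemma boundary_dist_pos:
  assumes "z \<in> \<Omega>"
  shows "0 < boundary_dist \<Omega> z"
proof -
  have "z \<notin> frontier \<Omega>"
    using assms open_domain by (simp add: frontier_def interior_open)
  then show ?thesis
    unfolding boundary_dist_def using frontier_nonempty by (simp add: infdist_pos_not_in_closed)
qed

lemma closed_annulus_subset_domain:
  assumes a: "a \<in> frontier \<Omega>" and "0 < s" "s \<le> r" and p: "p \<in> \<Omega>" "s \<le> boundary_dist \<Omega> p"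
    and disjoint: "frontier \<Omega> \<inter> closed_annulus a s r = {}"
  shows "closed_annulus a s r \<subseteq> \<Omega>"
proof (rule ccontr)
  assume "\<not> closed_annulus a s r \<subseteq> \<Omega>"
  moreover have "connected {z. s \<le> norm (z - a) \<and> norm (z - a) \<le> r}"
    by (intro connected_annulus) simp
  then have "connected (closed_annulus a s r)"
    by (simp add: closed_annulus_def dist_norm norm_minus_commute)
  ultimately have avoids: "closed_annulus a s r \<inter> \<Omega> = {}"
    using disjoint connected_Int_frontier[of "closed_annulus a s r" \<Omega>] by blast
  have "a \<in> closure \<Omega>"
    using a by (simp add: frontier_def)
  then obtain y where "y \<in> \<Omega>" "dist y a < s"
    using \<open>0 < s\<close> by (meson closure_approachable)
  then have "\<Omega> \<inter> ball a s \<noteq> {}"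
    by (auto simp: dist_commute)
  moreover have "p \<in> \<Omega> - ball a s"
    using p infdist_le[OF a, of p] by (auto simp: boundary_dist_def dist_commute)
  ultimately have "\<Omega> \<inter> frontier (ball a s) \<noteq> {}"
    using connected_Int_frontier[OF connected_domain, of "ball a s"] by blast
  moreover have "frontier (ball a s) \<subseteq> closed_annulus a s r"
    using \<open>0 < s\<close> \<open>s \<le> r\<close> by auto
  ultimately show False
    using avoids by blast
qed

lemma bergman_kernel_ge_at_dist:
  assumes lower: "bergman_lower_bound \<Omega> \<epsilon> c \<phi>"
    and "0 \<le> c" and a: "a \<in> frontier \<Omega>" and "z \<in> \<Omega>" "dist a z < \<epsilon>"
    and \<phi>_pos: "\<forall>t\<in>{0<..dist a z}. 0 < \<phi> t" and \<phi>_mono: "mono_on {0<..dist a z} (\<lambda>t. t\<^sup>2 * \<phi> t)"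
  shows "c / ((dist a z)\<^sup>2 * \<phi> (dist a z)) \<le> bergman_kernel \<Omega> z"
proof -
  define \<rho> \<delta> where "\<rho> = dist a z" and "\<delta> = boundary_dist \<Omega> z"
  have \<delta>: "0 < \<delta>" "\<delta> \<le> \<rho>"
    using boundary_dist_pos[OF \<open>z \<in> \<Omega>\<close>] infdist_le[OF a, of z]
    by (auto simp: \<rho>_def \<delta>_def boundary_dist_def dist_commute)
  have "c / (\<rho>\<^sup>2 * \<phi> \<rho>) \<le> c / (\<delta>\<^sup>2 * \<phi> \<delta>)"
  proof (rule divide_left_mono)
    show "\<delta>\<^sup>2 * \<phi> \<delta> \<le> \<rho>\<^sup>2 * \<phi> \<rho>"
      using mono_onD[OF \<phi>_mono, of \<delta> \<rho>] \<delta> by (simp flip: \<rho>_def)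
    show "0 < (\<rho>\<^sup>2 * \<phi> \<rho>) * (\<delta>\<^sup>2 * \<phi> \<delta>)"
      using \<phi>_pos \<delta> by (intro mult_pos_pos zero_less_power) (auto simp: \<rho>_def)
  qed fact
  also have "\<dots> \<le> bergman_kernel \<Omega> z"
    using lower \<open>z \<in> \<Omega>\<close> \<open>dist a z < \<epsilon>\<close> \<delta>(2) by (simp add: bergman_lower_bound_def \<delta>_def \<rho>_def)
  finally show ?thesis
    by (simp add: \<rho>_def)
qed

lemma bergman_lower_bound_on_annulus:
  assumes lower: "bergman_lower_bound \<Omega> \<epsilon> c \<phi>"
    and "0 \<le> c" and a: "a \<in> frontier \<Omega>" and "0 < r" "1 \<le> L" "r / L < \<epsilon>"
    and A: "closed_annulus a (r * exp (- L)) r \<subseteq> \<Omega>"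
    and \<phi>: "\<forall>t\<in>{0<..r / L}. 0 < \<phi> t" "mono_on {0<..r / L} (\<lambda>t. t\<^sup>2 * \<phi> t)"
    and upper: "\<And>z. dist a z = r / L \<Longrightarrow> bergman_kernel \<Omega> z * (r / L)\<^sup>2 \<le> \<eta> / L"
  shows "c * L \<le> \<eta> * \<phi> (r / L)"
proof -
  define z where "z = a + of_real (r / L)"
  have z: "dist a z = r / L"
    using \<open>0 < r\<close> \<open>1 \<le> L\<close> by (simp add: z_def dist_norm norm_divide)
  have "L \<le> exp L"
    using exp_ge_add_one_self[of L] by linarith
  then have "exp (- L) \<le> 1 / L"
    using \<open>1 \<le> L\<close> by (simp add: exp_minus field_simps)
  from mult_left_mono[OF this, of r] have "z \<in> \<Omega>"
    using \<open>0 < r\<close> \<open>1 \<le> L\<close> by (intro subsetD[OF A]) (simp add: z divide_le_eq)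
  have "c / ((r / L)\<^sup>2 * \<phi> (r / L)) \<le> bergman_kernel \<Omega> z"
    using bergman_kernel_ge_at_dist[OF lower \<open>0 \<le> c\<close> a \<open>z \<in> \<Omega>\<close>] \<phi> \<open>r / L < \<epsilon>\<close> by (simp only: z)
  then have "c / ((r / L)\<^sup>2 * \<phi> (r / L)) * (r / L)\<^sup>2 \<le> bergman_kernel \<Omega> z * (r / L)\<^sup>2"
    by (rule mult_right_mono) simp
  also have "\<dots> \<le> \<eta> / L"
    using z by (rule upper)
  finally have "c / \<phi> (r / L) \<le> \<eta> / L"
    using \<open>0 < r\<close> \<open>1 \<le> L\<close> by simp
  then show ?thesis
    using \<phi>(1) \<open>0 < r\<close> \<open>1 \<le> L\<close> by (simp add: field_simps)
qed

lemma frontier_meets_annulus: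
  assumes lower: "bergman_lower_bound \<Omega> \<epsilon> c \<phi>"
    and p: "p \<in> \<Omega>" and \<kappa>: "0 < \<kappa>" "\<kappa> < 2 * pi * c"
  shows "\<forall>\<^sub>F L in at_top. \<forall>a\<in>frontier \<Omega>. \<forall>r>0.
    r / L < \<epsilon> \<longrightarrow> r * exp (- L) \<le> boundary_dist \<Omega> p \<longrightarrow>
    (\<forall>t\<in>{0<..r / L}. 0 < \<phi> t) \<longrightarrow> mono_on {0<..r / L} (\<lambda>t. t\<^sup>2 * \<phi> t) \<longrightarrow> \<phi> (r / L) \<le> \<kappa> * L \<longrightarrow>
    frontier \<Omega> \<inter> closed_annulus a (r * exp (- L)) r \<noteq> {}"
proof -
  have "0 \<le> c"
    using less_trans[OF \<kappa>] by (simp add: zero_less_mult_iff)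
  have "1 / (2 * pi) < c / \<kappa>"
    using \<kappa> by (simp add: field_simps)
  then obtain \<eta> where \<eta>: "1 / (2 * pi) < \<eta>" "\<eta> < c / \<kappa>"
    using dense by blast
  have "0 < \<eta>"
    by (rule less_trans[OF _ \<eta>(1)]) simp
  from bergman_kernel_annulus_modulus[OF \<eta>(1)] eventually_ge_at_top[of 1]
  show ?thesis
  proof eventually_elim
    case (elim L)
    show ?case
    proof (intro ballI allI impI notI)
      fix a and r :: real
      assume a: "a \<in> frontier \<Omega>" and r: "0 < r" "r / L < \<epsilon>" and "r * exp (- L) \<le> boundary_dist \<Omega> p"
        and \<phi>: "\<forall>t\<in>{0<..r / L}. 0 < \<phi> t" "mono_on {0<..r / L} (\<lambda>t. t\<^sup>2 * \<phi> t)"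
        and \<phi>_le: "\<phi> (r / L) \<le> \<kappa> * L"
        and "frontier \<Omega> \<inter> closed_annulus a (r * exp (- L)) r = {}"
      then have A: "closed_annulus a (r * exp (- L)) r \<subseteq> \<Omega>"
        using p elim by (intro closed_annulus_subset_domain[where p = p]) auto
      have "bergman_kernel \<Omega> z * (r / L)\<^sup>2 \<le> \<eta> / L" if "dist a z = r / L" for z
        using elim(1) open_domain \<open>0 < r\<close> A that by blast
      from bergman_lower_bound_on_annulus[OF lower \<open>0 \<le> c\<close> a r(1) elim(2) r(2) A \<phi> this]
      have "c * L \<le> \<eta> * \<phi> (r / L)" .
      also have "\<dots> \<le> \<eta> * \<kappa> * L"
        using \<phi>_le \<open>0 < \<eta>\<close> by (simp add: mult.assoc)
      also have "\<dots> < c * L"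
        using \<eta>(2) \<kappa>(1) elim by (simp add: field_simps)
      finally show False
        by simp
    qed
  qed
qed

lemma frontier_meets_annuli_of_fixed_modulus:
  assumes lower: "bergman_lower_bound \<Omega> \<epsilon> c (\<lambda>_. 1)" and "0 < \<epsilon>" "0 < c"
  obtains L where "0 < L" "\<And>a r. a \<in> frontier \<Omega> \<Longrightarrow> 0 < r \<Longrightarrow> r < D \<Longrightarrow>
    frontier \<Omega> \<inter> closed_annulus a (r * exp (- L)) r \<noteq> {}"
proof -
  obtain p where p: "p \<in> \<Omega>"
    using domain_nonempty by blast
  have "0 < pi * c" "pi * c < 2 * pi * c"
    using \<open>0 < c\<close> by simp_all
  from frontier_meets_annulus[OF lower p this]
  have meets: "\<forall>\<^sub>F L in at_top. \<forall>a\<in>frontier \<Omega>. \<forall>r>0. r / L < \<epsilon> \<longrightarrow> r * exp (- L) \<le> boundary_dist \<Omega> p \<longrightarrow>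
      1 \<le> pi * c * L \<longrightarrow> frontier \<Omega> \<inter> closed_annulus a (r * exp (- L)) r \<noteq> {}"
    by eventually_elim (simp add: mono_on_def power_mono)
  have "((\<lambda>L. D / L) \<longlongrightarrow> 0) at_top" "((\<lambda>L. D * exp (- L)) \<longlongrightarrow> 0) at_top"
    by real_asymp+
  then have "\<forall>\<^sub>F L in at_top. D / L < \<epsilon>" "\<forall>\<^sub>F L in at_top. D * exp (- L) < boundary_dist \<Omega> p"
    using \<open>0 < \<epsilon>\<close> boundary_dist_pos[OF p] by (auto elim: order_tendstoD)
  moreover have "\<forall>\<^sub>F L in at_top. 1 \<le> pi * c * L" "\<forall>\<^sub>F L::real in at_top. 0 < L"
    using \<open>0 < c\<close> by real_asymp+
  ultimately have "\<forall>\<^sub>F L in at_top. D / L < \<epsilon> \<and> D * exp (- L) < boundary_dist \<Omega> p \<and> 1 \<le> pi * c * L \<and> 0 < L"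
    by eventually_elim simp
  from eventually_happens'[OF trivial_limit_at_top_linorder eventually_conj[OF this meets]]
  obtain L where L: "D / L < \<epsilon>" "D * exp (- L) < boundary_dist \<Omega> p" "1 \<le> pi * c * L" "0 < L"
    and meets_L: "\<And>a r. a \<in> frontier \<Omega> \<Longrightarrow> 0 < r \<Longrightarrow> r / L < \<epsilon> \<Longrightarrow> r * exp (- L) \<le> boundary_dist \<Omega> p \<Longrightarrow>
      frontier \<Omega> \<inter> closed_annulus a (r * exp (- L)) r \<noteq> {}"
    by blast
  show thesis
  proof (rule that[OF \<open>0 < L\<close>])
    fix a r assume "a \<in> frontier \<Omega>" and r: "0 < r" "r < D"
    have "r / L < D / L" "r * exp (- L) < D * exp (- L)"
      using r \<open>0 < L\<close> by (auto intro: divide_strict_right_mono)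
    then have "r / L < \<epsilon>" "r * exp (- L) \<le> boundary_dist \<Omega> p"
      using L by linarith+
    then show "frontier \<Omega> \<inter> closed_annulus a (r * exp (- L)) r \<noteq> {}"
      using meets_L \<open>a \<in> frontier \<Omega>\<close> r(1) by blast
  qed
qed

lemma uniformly_perfect_frontier:
  assumes "bergman_lower_bound \<Omega> \<epsilon> c (\<lambda>_. 1)" and "0 < \<epsilon>" "0 < c"
  shows "uniformly_perfect (frontier \<Omega>)"
proof -
  obtain L where "0 < L" and meets: "\<And>a r. a \<in> frontier \<Omega> \<Longrightarrow> 0 < r \<Longrightarrow> r < diameter (frontier \<Omega>) \<Longrightarrow>
      frontier \<Omega> \<inter> closed_annulus a (r * exp (- L)) r \<noteq> {}"
    using frontier_meets_annuli_of_fixed_modulus[OF assms] by blast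
  show ?thesis
    unfolding uniformly_perfect_def
  proof (intro conjI exI[of _ "exp (- L)"] ballI allI impI)
    fix a r assume "a \<in> frontier \<Omega>" "0 < r \<and> r < diameter (frontier \<Omega>)"
    then show "\<exists>z\<in>frontier \<Omega>. exp (- L) * r \<le> cmod (z - a) \<and> cmod (z - a) \<le> r"
      using meets[of a r] by (force simp: dist_norm norm_minus_commute mult.commute)
  qed (use \<open>0 < L\<close> in auto)
qed

lemma frontier_meets_small_annuli:
  assumes lower: "bergman_lower_bound \<Omega> \<epsilon> c \<phi>" and "0 < \<epsilon>"
    and \<phi>: "0 < t0" "\<And>t. t \<in> {0<..t0} \<Longrightarrow> 0 < \<phi> t" "mono_on {0<..t0} (\<lambda>t. t\<^sup>2 * \<phi> t)"
    and L: "filterlim L at_top (at_right 0)"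
    and ratio: "((\<lambda>r. \<phi> (r / L r) / L r) \<longlongrightarrow> l) (at_right 0)" and l: "0 \<le> l" "l < 2 * pi * c"
  shows "\<forall>\<^sub>F r in at_right 0. \<forall>a\<in>frontier \<Omega>. frontier \<Omega> \<inter> closed_annulus a (r * exp (- L r)) r \<noteq> {}"
proof -
  obtain p where p: "p \<in> \<Omega>"
    using domain_nonempty by blast
  obtain \<kappa> where \<kappa>: "l < \<kappa>" "\<kappa> < 2 * pi * c"
    using dense[OF l(2)] by blast
  then have "0 < \<kappa>"
    using l(1) by linarith
  have "\<forall>\<^sub>F r in at_right 0. 0 < r \<and> r < min \<epsilon> (min t0 (boundary_dist \<Omega> p))"
    using \<open>0 < \<epsilon>\<close> \<phi>(1) boundary_dist_pos[OF p]
    by (intro eventually_at_rightI[of 0 "min \<epsilon> (min t0 (boundary_dist \<Omega> p))"]) auto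
  moreover have "\<forall>\<^sub>F r in at_right 0. 1 \<le> L r"
    using L by (simp add: filterlim_at_top)
  moreover have "\<forall>\<^sub>F r in at_right 0. \<phi> (r / L r) / L r < \<kappa>"
    using ratio \<kappa>(1) by (rule order_tendstoD)
  moreover note eventually_compose_filterlim[OF frontier_meets_annulus[OF lower p \<open>0 < \<kappa>\<close> \<kappa>(2)] L]
  ultimately show ?thesis
  proof eventually_elim
    case (elim r)
    have "r / L r \<le> r" "r * exp (- L r) \<le> r"
      using elim by (auto simp: divide_le_eq mult_left_le)
    then have "r / L r < \<epsilon>" "r / L r \<le> t0" "r * exp (- L r) \<le> boundary_dist \<Omega> p"
      using elim by linarith+
    moreover have "\<phi> (r / L r) \<le> \<kappa> * L r"
      using elim by (simp add: field_simps)
    moreover have "mono_on {0<..r / L r} (\<lambda>t. t\<^sup>2 * \<phi> t)"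
      using \<phi>(3) by (rule mono_on_subset) (use \<open>r / L r \<le> t0\<close> in auto)
    ultimately show ?case
      using elim \<phi>(2) by auto
  qed
qed

lemma condU1_frontier:
  assumes "bergman_lower_bound \<Omega> \<epsilon> M (\<lambda>t. ln (1 / t))" and "0 < \<epsilon>" "0 < M"
    and \<alpha>: "1 + 1 / (2 * pi * M) < \<alpha>"
  shows "condU1 \<alpha> (frontier \<Omega>)"
proof (rule condU1I)
  define b where "b = \<alpha> - 1"
  have "1 / (2 * pi * M) < b"
    using \<alpha> by (simp add: b_def)
  moreover from this have "0 < b"
    by (rule less_trans[rotated]) (use \<open>0 < M\<close> in simp)
  ultimately have b: "0 < b" "1 / b < 2 * pi * M"
    using \<open>0 < M\<close> by (simp_all add: field_simps)
  then show "1 \<le> \<alpha>"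
    by (simp add: b_def)
  define L where "L r = b * ln (1 / r)" for r :: real
  have "\<forall>\<^sub>F r in at_right 0. \<forall>a\<in>frontier \<Omega>. frontier \<Omega> \<inter> closed_annulus a (r * exp (- L r)) r \<noteq> {}"
  proof (rule frontier_meets_small_annuli[OF assms(1,2)])
    show "mono_on {0<..exp (- (1 / 2))} (\<lambda>t::real. t\<^sup>2 * ln (1 / t))"
      by (rule mono_on_square_times_ln)
    show "0 < ln (1 / t)" if "t \<in> {0<..exp (- (1 / 2))}" for t :: real
      using that by (intro less_le_trans[OF _ ln_inverse_ge[of t "1 / 2"]]) auto
    show "filterlim L at_top (at_right 0)"
      using b(1) unfolding L_def by real_asymp
    show "((\<lambda>r. ln (1 / (r / L r)) / L r) \<longlongrightarrow> 1 / b) (at_right 0)"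
      using b(1) unfolding L_def by (real_asymp simp: inverse_eq_divide)
  qed (use b in auto)
  moreover have "\<forall>\<^sub>F r in at_right 0. r * exp (- L r) = h1 \<alpha> r"
    using eventually_at_right_less[of 0]
    by eventually_elim (simp add: L_def h1_def b_def powr_def ln_div left_diff_distrib exp_diff)
  ultimately show "\<forall>\<^sub>F r in at_right 0. \<forall>a\<in>frontier \<Omega>. frontier \<Omega> \<inter> closed_annulus a (h1 \<alpha> r) r \<noteq> {}"
    by eventually_elim simp
qed simp

lemma ex_condU1_frontier:
  assumes "bergman_lower_bound \<Omega> \<epsilon> M (\<lambda>t. ln (1 / t))" and "0 < \<epsilon>" "0 < M"
  shows "\<exists>\<alpha>>1. condU1 \<alpha> (frontier \<Omega>)"
  using assms by (intro exI[of _ "1 + 1 / (pi * M)"] conjI condU1_frontier[of _ M]) (auto simp: field_simps)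

lemma ex_condU1_frontier_less_2:
  assumes lower: "bergman_lower_bound \<Omega> \<epsilon> M (\<lambda>t. ln (1 / t))" and "0 < \<epsilon>" and M: "1 / (2 * pi) < M"
  shows "\<exists>\<alpha>>1. \<alpha> < 2 \<and> condU1 \<alpha> (frontier \<Omega>)"
proof -
  have "0 < M"
    by (rule less_trans[OF _ M]) simp
  then have "1 + 1 / (2 * pi * M) < 2"
    using M by (simp add: field_simps)
  then obtain \<alpha> where \<alpha>: "1 + 1 / (2 * pi * M) < \<alpha>" "\<alpha> < 2"
    using dense by blast
  moreover have "0 < 1 / (2 * pi * M)"
    using \<open>0 < M\<close> by simp
  ultimately show ?thesis
    using condU1_frontier[OF lower \<open>0 < \<epsilon>\<close> \<open>0 < M\<close> \<alpha>(1)] by (intro exI[of _ \<alpha>]) linarith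
qed

lemma condU2_frontier:
  assumes "bergman_lower_bound \<Omega> \<epsilon> c (\<lambda>t. ln (ln (1 / t)))" and "0 < \<epsilon>" "0 < c"
    and \<beta>: "1 / (2 * pi * c) < \<beta>"
  shows "condU2 \<beta> (frontier \<Omega>)"
proof (rule condU2I)
  from \<beta> have "0 < \<beta>"
    by (rule less_trans[rotated]) (use \<open>0 < c\<close> in simp)
  with \<beta> have \<beta>': "0 < \<beta>" "1 / \<beta> < 2 * pi * c"
    using \<open>0 < c\<close> by (simp_all add: field_simps)
  then show "0 \<le> \<beta>"
    by simp
  define L where "L r = \<beta> * ln (- ln r)" for r :: real
  have "\<forall>\<^sub>F r in at_right 0. \<forall>a\<in>frontier \<Omega>. frontier \<Omega> \<inter> closed_annulus a (r * exp (- L r)) r \<noteq> {}"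
  proof (rule frontier_meets_small_annuli[OF assms(1,2)])
    show "mono_on {0<..exp (- exp (1 / 2))} (\<lambda>t::real. t\<^sup>2 * ln (ln (1 / t)))"
      by (rule mono_on_square_times_ln_ln)
    show "0 < ln (ln (1 / t))" if "t \<in> {0<..exp (- exp (1 / 2))}" for t :: real
      using that by (intro less_le_trans[OF _ ln_ln_inverse_ge[of t "1 / 2"]]) auto
    show "filterlim L at_top (at_right 0)"
      using \<beta>'(1) unfolding L_def by real_asymp
    show "((\<lambda>r. ln (ln (1 / (r / L r))) / L r) \<longlongrightarrow> 1 / \<beta>) (at_right 0)"
      using \<beta>'(1) unfolding L_def by (real_asymp simp: inverse_eq_divide)
  qed (use \<beta>' in auto)
  moreover have "\<forall>\<^sub>F r in at_right 0. r * exp (- L r) = h2 \<beta> r"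
    using eventually_at_right_real[OF zero_less_one]
    by eventually_elim (auto simp: L_def h2_def powr_def)
  ultimately show "\<forall>\<^sub>F r in at_right 0. \<forall>a\<in>frontier \<Omega>. frontier \<Omega> \<inter> closed_annulus a (h2 \<beta> r) r \<noteq> {}"
    by eventually_elim simp
qed simp

lemma ex_condU2_frontier:
  assumes "bergman_lower_bound \<Omega> \<epsilon> c (\<lambda>t. ln (ln (1 / t)))" and "0 < \<epsilon>" "0 < c"
  shows "\<exists>\<beta>>0. condU2 \<beta> (frontier \<Omega>)"
  using assms by (intro exI[of _ "1 / (pi * c)"] conjI condU2_frontier[of _ c]) (auto simp: field_simps)

end

theorem theorem1p1:
  fixes \<Omega> :: "complex set"
  assumes "open \<Omega>" and "connected \<Omega>" and "\<Omega> \<noteq> {}" and "\<Omega> \<noteq> UNIV"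
  shows
   "(bounded \<Omega> \<and>
     (\<exists>c>0. \<exists>\<epsilon>>0. \<forall>z\<in>\<Omega>. boundary_dist \<Omega> z < \<epsilon> \<longrightarrow>
        bergman_kernel \<Omega> z \<ge> c / (boundary_dist \<Omega> z)\<^sup>2)
      \<longrightarrow> uniformly_perfect (frontier \<Omega>))
    \<and>
    (\<forall>M>0. (\<exists>\<epsilon>>0. \<forall>z\<in>\<Omega>. boundary_dist \<Omega> z < \<epsilon> \<longrightarrow>
        bergman_kernel \<Omega> z \<ge> M / ((boundary_dist \<Omega> z)\<^sup>2 * ln (1 / boundary_dist \<Omega> z)))
      \<longrightarrow> (\<exists>\<alpha>>1. condU1 \<alpha> (frontier \<Omega>))
         \<and> (M > 1 / (2 * pi) \<longrightarrow> (\<exists>\<alpha>. 1 < \<alpha> \<and> \<alpha> < 2 \<and> condU1 \<alpha> (frontier \<Omega>))))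
    \<and>
    (\<forall>c>0. (\<exists>\<epsilon>>0. \<forall>z\<in>\<Omega>. boundary_dist \<Omega> z < \<epsilon> \<longrightarrow>
        bergman_kernel \<Omega> z \<ge> c / ((boundary_dist \<Omega> z)\<^sup>2 * ln (ln (1 / boundary_dist \<Omega> z))))
      \<longrightarrow> (\<exists>\<beta>>0. condU2 \<beta> (frontier \<Omega>)))"
proof -
  interpret proper_domain \<Omega>
    using assms by unfold_locales
  show ?thesis
    using uniformly_perfect_frontier ex_condU1_frontier ex_condU1_frontier_less_2 ex_condU2_frontier
    unfolding bergman_lower_bound_def mult_1_right by (intro conjI allI impI) blast+
qed

end
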